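(* Let $V$ be an optimal prefix-free machine and let $T>0$ be real. Define $\Theta_V(T)=\sum_{s\in\{0,1\}^*,\,H_V(s)<|s|}2^{-|s|/T}$. Then: (i) if $T$ is computable and $0<T\le 1$, then $\Theta_V(T)$ is a left-computable real which is weakly Chaitin $T$-random; (ii) if $T$ is computable and $0<T<1$, then $\Theta_V(T)$ is strictly $T$-compressible; (iii) if $1<T$, then $\Theta_V(T)$ diverges to $\infty$.
   Context: $\{0,1\}^*$ is the set of finite binary strings; $|s|$ is the length of $s$. A prefix-free machine is a partial recursive function $C:\{0,1\}^*\to\{0,1\}^*$ whose domain is prefix-free. $H_C(s)=\min\{|p| : C(p)=s\}$ (possibly $\infty$). A prefix-free machine $U$ is optimal if for every prefix-free machine $C$ there is $d\in\mathbb{N}$ such that for every $p\in\mathrm{Dom}\,C$ there is $q\in\mathrm{Dom}\,U$ with $U(q)=C(p)$ and $|q|\le|p|+d$. A particular optimal prefix-free machine $U$ is fixed and $H(s):=H_U(s)$. For a real $\alpha$ and $n\ge1$, $\alpha\restriction n$ denotes the first $n$ bits of the base-two expansion of $\alpha-\lfloor\alpha\rfloor$ (the expansion with infinitely many zeros). A real $\alpha$ is computable if there is a total recursive $f:\mathbb{N}^+\to\mathbb{Q}$ with $|\alpha-f(n)|<1/n$ for all $n$; right-computable if there is a total recursive $f:\mathbb{N}^+\to\mathbb{Q}$ with $\alpha\le f(n)$ for all $n$ and $f(n)\to\alpha$; left-computable if $-\alpha$ is right-computable. For $T\in(0,1]$, $\alpha$ is weakly Chaitin $T$-random if there is $c\in\mathbb{N}$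 with $Tn-c\le H(\alpha\restriction n)$ for all $n\in\mathbb{N}^+$; $\alpha$ is strictly $T$-compressible if there is $d\in\mathbb{N}$ with $H(\alpha\restriction n)\le Tn+d$ for all $n\in\mathbb{N}^+$. *)

theory Defs
  imports "HOL-Analysis.Analysis" "HOL-Library.Sublist" "HOL-Library.Nat_Bijection"
begin

datatype recf = Zero | Succ | Proj nat | Comp recf "recf list" | Prim recf recf | Mn recf

inductive eval :: "recf \<Rightarrow> nat list \<Rightarrow> nat \<Rightarrow> bool" where
  eval_Zero: "eval Zero xs 0"
| eval_Succ: "eval Succ (x # xs) (Suc x)"
| eval_Proj: "i < length xs \<Longrightarrow> eval (Proj i) xs (xs ! i)"
| eval_Comp: "length ys = length gs \<Longrightarrow> (\<forall>i<length gs. eval (gs ! i) xs (ys ! i))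
              \<Longrightarrow> eval f ys z \<Longrightarrow> eval (Comp f gs) xs z"
| eval_Prim0: "eval f xs y \<Longrightarrow> eval (Prim f g) (0 # xs) y"
| eval_PrimS: "eval (Prim f g) (n # xs) r \<Longrightarrow> eval g (r # n # xs) y
              \<Longrightarrow> eval (Prim f g) (Suc n # xs) y"
| eval_Mn: "eval f (n # xs) 0 \<Longrightarrow> (\<forall>m<n. \<exists>y. y \<noteq> 0 \<and> eval f (m # xs) y)
              \<Longrightarrow> eval (Mn f) xs n"

text \<open>A computable bijection between finite binary strings and nat (bijective base 2).\<close>
fun str_nat :: "bool list \<Rightarrow> nat" where
  "str_nat [] = 0"
| "str_nat (b # s) = 2 * str_nat s + (if b then 2 else 1)"

definition prefix_free_machine :: "(bool list \<Rightarrow> bool list option) \<Rightarrow> bool" where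
  "prefix_free_machine C \<longleftrightarrow>
     (\<exists>r. \<forall>p y. C p = Some y \<longleftrightarrow> eval r [str_nat p] (str_nat y)) \<and>
     (\<forall>p q. p \<in> dom C \<longrightarrow> q \<in> dom C \<longrightarrow> prefix p q \<longrightarrow> p = q)"

text \<open>H_C(s) = min {|p| : C(p) = s}, infinite if there is no such p.\<close>
definition Hc :: "(bool list \<Rightarrow> bool list option) \<Rightarrow> bool list \<Rightarrow> enat" where
  "Hc C s = (INF p \<in> {p. C p = Some s}. enat (length p))"

definition optimal_machine :: "(bool list \<Rightarrow> bool list option) \<Rightarrow> bool" where
  "optimal_machine U \<longleftrightarrow> prefix_free_machine U \<and>
     (\<forall>C. prefix_free_machine C \<longrightarrow>
        (\<exists>d::nat. \<forall>p \<in> dom C. \<exists>q \<in> dom U. U q = C p \<and> length q \<le> length p + d))"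

text \<open>alpha restricted to n: the first n bits of the base-two expansion of alpha - floor alpha
  (expansion with infinitely many zeros); the k-th bit (k >= 1) is floor(2^k frac alpha) mod 2.\<close>
definition real_bits :: "real \<Rightarrow> nat \<Rightarrow> bool list" where
  "real_bits \<alpha> n = map (\<lambda>k. odd (nat \<lfloor>2 ^ (k + 1) * frac \<alpha>\<rfloor>)) [0..<n]"

definition total_recursive_rat :: "(nat \<Rightarrow> rat) \<Rightarrow> bool" where
  "total_recursive_rat f \<longleftrightarrow>
     (\<exists>ra rb. \<forall>n. eval ra [n] (int_encode (fst (quotient_of (f n)))) \<and>
                  eval rb [n] (nat (snd (quotient_of (f n)))))"

definition computable_real :: "real \<Rightarrow> bool" where
  "computable_real \<alpha> \<longleftrightarrow>
     (\<exists>f. total_recursive_rat f \<and> (\<forall>n\<ge>1. \<bar>\<alpha> - real_of_rat (f n)\<bar> < 1 / real n))"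

definition right_computable :: "real \<Rightarrow> bool" where
  "right_computable \<alpha> \<longleftrightarrow>
     (\<exists>f. total_recursive_rat f \<and> (\<forall>n\<ge>1. \<alpha> \<le> real_of_rat (f n)) \<and>
          (\<lambda>n. real_of_rat (f n)) \<longlonglongrightarrow> \<alpha>)"

definition left_computable :: "real \<Rightarrow> bool" where
  "left_computable \<alpha> \<longleftrightarrow> right_computable (- \<alpha>)"

definition weakly_Chaitin_random :: "(bool list \<Rightarrow> bool list option) \<Rightarrow> real \<Rightarrow> real \<Rightarrow> bool" where
  "weakly_Chaitin_random U T \<alpha> \<longleftrightarrow>
     (\<exists>c::nat. \<forall>n\<ge>1. ereal (T * real n - real c) \<le> ereal_of_enat (Hc U (real_bits \<alpha> n)))"

definition strictly_compressible :: "(bool list \<Rightarrow> bool list option) \<Rightarrow> real \<Rightarrow> real \<Rightarrow> bool" where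
  "strictly_compressible U T \<alpha> \<longleftrightarrow>
     (\<exists>d::nat. \<forall>n\<ge>1. ereal_of_enat (Hc U (real_bits \<alpha> n)) \<le> ereal (T * real n + real d))"

definition Theta_set :: "(bool list \<Rightarrow> bool list option) \<Rightarrow> bool list set" where
  "Theta_set V = {s. Hc V s < enat (length s)}"

definition Theta_term :: "real \<Rightarrow> bool list \<Rightarrow> real" where
  "Theta_term T s = 2 powr (- real (length s) / T)"

definition Theta :: "(bool list \<Rightarrow> bool list option) \<Rightarrow> real \<Rightarrow> real" where
  "Theta V T = (\<Sum>\<^sub>\<infinity> s \<in> Theta_set V. Theta_term T s)"

end

theory Submission
  imports Defs
begin

text \<open>
  Fix a listing without repetition of the compressible strings. Their weights
  \<open>2 ^ - |s|\<close> sum to at most 1/2 by Kraft's inequality, so \<open>\<Theta>(T)\<close> converges for \<open>T \<le> 1\<close> and the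
  partial sums of the listing approximate it from below.

  Randomness: the first \<open>n\<close> bits of \<open>\<Theta>(T)\<close> let one find a stage after which every newly listed
  string has weight \<open>2 powr (- |s| / T)\<close> below \<open>2 / 2 ^ n\<close>, that is, length above \<open>T * (n - 1)\<close>. A string
  of length about \<open>T * n\<close> not listed by then is incompressible, so computing it costs \<open>T * n\<close> bits.

  Compressibility: each time the current lower bound crosses a multiple of \<open>2 ^ - n\<close>, request a program
  of length about \<open>T * n\<close> for the new value. At level \<open>n\<close> a listed string \<open>s\<close> causes at most about
  \<open>min 1 (2 ^ n * 2 powr (- |s| / T))\<close> requests; for \<open>T < 1\<close> the total weight of these over all \<open>n\<close> is
  \<open>O(2 ^ - |s|)\<close>, so the requests satisfy the Kraft--Chaitin condition.

  Divergence: appending \<open>2 * a\<close> zeros to all strings of length \<open>a * r\<close> gives \<open>2 ^ (a * r)\<close> compressible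
  strings of length \<open>a * (r + 2)\<close>, which together contribute at least 1 once \<open>r\<close> is large.
\<close>

section \<open>Recursive functions\<close>

text \<open>The obstacle is that \<open>T\<close> is known only through rational approximations. The
  terms \<open>2 powr (- |s| / T)\<close> are in general irrational, and their floors cannot be
  decided; what is available is the semidecidability of strict inequalities. Numerical choices are
  therefore phrased as relations between natural numbers given by strict inequalities, with enough
  slack that a solution always exists, and an effective search selects one. The additive constants
  of the theorem absorb the slack. The two halves use different approximations of
  \<open>Theta V T\<close>. Randomness needs only computable lower bounds that converge to it, so
  all terms may be rounded anew at each stage. Compressibility counts how often a floor changes over
  time; there each listed string adds one fixed nonnegative amount, rounded more finely the later it
  is listed and never revised.\<close>

inductive_cases eval_ZeroE: "eval Zero xs y"
inductive_cases eval_SuccE: "eval Succ xs y"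
inductive_cases eval_ProjE: "eval (Proj i) xs y"
inductive_cases eval_CompE: "eval (Comp f gs) xs y"
inductive_cases eval_Prim0E: "eval (Prim f g) (0 # xs) y"
inductive_cases eval_PrimSE: "eval (Prim f g) (Suc n # xs) y"
inductive_cases eval_MnE: "eval (Mn f) xs y"

lemma eval_deterministic: "eval r xs y \<Longrightarrow> eval r xs z \<Longrightarrow> y = z"
proof (induction arbitrary: z rule: eval.induct)
  case (eval_Comp ys gs xs f y)
  from eval_Comp.prems obtain zs where zs: "length zs = length gs"
    "\<forall>i<length gs. eval (gs ! i) xs (zs ! i)" "eval f zs z"
    by (rule eval_CompE)
  have "ys = zs" using eval_Comp.hyps(1) zs eval_Comp.IH(1) by (intro nth_equalityI; metis)
  with zs(3) eval_Comp.IH(2) show ?case by blast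
next
  case (eval_PrimS f g n xs r y)
  from eval_PrimS.prems obtain r' where "eval (Prim f g) (n # xs) r'" "eval g (r' # n # xs) z"
    by (rule eval_PrimSE)
  with eval_PrimS.IH show ?case by blast
next
  case (eval_Mn f n xs)
  from eval_Mn.prems have z: "eval f (z # xs) 0" "\<forall>m<z. \<exists>y. y \<noteq> 0 \<and> eval f (m # xs) y"
    by (rule eval_MnE; blast)+
  have "\<not> z < n" using eval_Mn.IH(2) z(1) by blast
  moreover have "\<not> n < z" using eval_Mn.IH(1) z(2) by blast
  ultimately show ?case by simp
next
  case (eval_Prim0 f xs y g)
  from eval_Prim0.prems have "eval f xs z" by (rule eval_Prim0E)
  then show ?case by (rule eval_Prim0.IH)
qed (blast elim: eval_ZeroE eval_SuccE eval_ProjE)+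

definition recursive_n :: "nat \<Rightarrow> (nat list \<Rightarrow> nat) \<Rightarrow> bool" where
  "recursive_n n F \<longleftrightarrow> (\<exists>r. \<forall>xs. length xs = n \<longrightarrow> eval r xs (F xs))"

lemma recursive_n_cong:
  assumes "recursive_n n F" "\<And>xs. length xs = n \<Longrightarrow> F xs = G xs"
  shows "recursive_n n G"
  using assms unfolding recursive_n_def by metis

lemma recursive_n_proj: "i < n \<Longrightarrow> recursive_n n (\<lambda>xs. xs ! i)"
  unfolding recursive_n_def by (metis eval_Proj)

lemma recursive_n_comp:
  assumes "\<forall>F\<in>set Fs. recursive_n n F" "recursive_n (length Fs) G"
  shows "recursive_n n (\<lambda>xs. G (map (\<lambda>F. F xs) Fs))"
proof -
  from assms(1) obtain rF where rF: "\<And>F xs. F \<in> set Fs \<Longrightarrow> length xs = n \<Longrightarrow> eval (rF F) xs (F xs)"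
    unfolding recursive_n_def by metis
  from assms(2) obtain rG where rG: "\<And>xs. length xs = length Fs \<Longrightarrow> eval rG xs (G xs)"
    unfolding recursive_n_def by metis
  have "eval (Comp rG (map rF Fs)) xs (G (map (\<lambda>F. F xs) Fs))" if "length xs = n" for xs
    by (rule eval_Comp[where ys = "map (\<lambda>F. F xs) Fs"]) (use rF rG that in auto)
  then show ?thesis unfolding recursive_n_def by blast
qed

lemma recursive_n_Suc: "recursive_n n F \<Longrightarrow> recursive_n n (\<lambda>xs. Suc (F xs))"
proof -
  assume F: "recursive_n n F"
  have "recursive_n (length [F]) (\<lambda>xs. Suc (xs ! 0))"
    unfolding recursive_n_def
    by (intro exI[of _ Succ]) (auto simp: length_Suc_conv intro: eval_Succ)
  from recursive_n_comp[OF _ this] F show ?thesis by simp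
qed

lemma recursive_n_const: "recursive_n n (\<lambda>_. c)"
proof (induction c)
  case 0
  show ?case unfolding recursive_n_def using eval_Zero by blast
next
  case (Suc c)
  then show ?case by (rule recursive_n_Suc)
qed

lemma recursive_n_comp1:
  assumes "recursive_n 1 (\<lambda>xs. G (xs ! 0))" "recursive_n n A"
  shows "recursive_n n (\<lambda>xs. G (A xs))"
  using recursive_n_comp[of "[A]" n "\<lambda>xs. G (xs ! 0)"] assms by simp

lemma recursive_n_comp2:
  assumes "recursive_n 2 (\<lambda>xs. G (xs ! 0) (xs ! 1))" "recursive_n n A" "recursive_n n B"
  shows "recursive_n n (\<lambda>xs. G (A xs) (B xs))"
  using recursive_n_comp[of "[A, B]" n "\<lambda>xs. G (xs ! 0) (xs ! 1)"] assms
  by (simp add: numeral_2_eq_2)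

lemma recursive_n_prim:
  assumes "recursive_n n A" "recursive_n (Suc (Suc n)) G"
  shows "recursive_n (Suc n) (\<lambda>xs. rec_nat (A (tl xs)) (\<lambda>m r. G (r # m # tl xs)) (hd xs))"
proof -
  from assms obtain ra rg where ra: "\<And>xs. length xs = n \<Longrightarrow> eval ra xs (A xs)"
    and rg: "\<And>xs. length xs = Suc (Suc n) \<Longrightarrow> eval rg xs (G xs)"
    unfolding recursive_n_def by metis
  have "eval (Prim ra rg) (m # xs) (rec_nat (A xs) (\<lambda>m r. G (r # m # xs)) m)" if "length xs = n" for m xs
    by (induction m) (use that ra rg in \<open>auto intro: eval_Prim0 eval_PrimS\<close>)
  then show ?thesis unfolding recursive_n_def
    by (intro exI[of _ "Prim ra rg"]) (auto simp: length_Suc_conv)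
qed

lemma recursive_n_Least:
  assumes "recursive_n (Suc n) F" "\<And>xs. length xs = n \<Longrightarrow> \<exists>m. F (m # xs) = 0"
  shows "recursive_n n (\<lambda>xs. LEAST m. F (m # xs) = 0)"
proof -
  from assms(1) obtain r where r: "\<And>xs. length xs = Suc n \<Longrightarrow> eval r xs (F xs)"
    unfolding recursive_n_def by metis
  have "eval (Mn r) xs (LEAST m. F (m # xs) = 0)" if xs: "length xs = n" for xs
  proof (rule eval_Mn)
    have "F ((LEAST m. F (m # xs) = 0) # xs) = 0" using assms(2)[OF xs] by (rule LeastI_ex)
    then show "eval r ((LEAST m. F (m # xs) = 0) # xs) 0" using r[of "(LEAST m. F (m # xs) = 0) # xs"] xs by simp
    show "\<forall>m<LEAST m. F (m # xs) = 0. \<exists>y. y \<noteq> 0 \<and> eval r (m # xs) y"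
    proof (intro allI impI exI conjI)
      fix m assume "m < (LEAST m. F (m # xs) = 0)"
      then show "F (m # xs) \<noteq> 0" by (rule not_less_Least)
      show "eval r (m # xs) (F (m # xs))" using r xs by simp
    qed
  qed
  then show ?thesis unfolding recursive_n_def by blast
qed

lemma recursive_n_rec_unary:
  assumes "recursive_n 2 (\<lambda>xs. G (xs ! 0) (xs ! 1))"
  shows "recursive_n 1 (\<lambda>xs. rec_nat c (\<lambda>m r. G m r) (xs ! 0))"
proof -
  have "recursive_n (Suc (Suc 0)) (\<lambda>xs. G (xs ! 1) (xs ! 0))"
    by (rule recursive_n_comp2[OF assms]) (intro recursive_n_proj; simp)+
  from recursive_n_prim[OF recursive_n_const this]
  have "recursive_n 1 (\<lambda>xs. rec_nat c (\<lambda>m r. G m r) (hd xs))" by simp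
  then show ?thesis
  proof (rule recursive_n_cong)
    fix xs :: "nat list" assume "length xs = 1"
    then have "hd xs = xs ! 0" by (cases xs) auto
    then show "rec_nat c (\<lambda>m r. G m r) (hd xs) = rec_nat c (\<lambda>m r. G m r) (xs ! 0)" by (rule arg_cong)
  qed
qed

lemma recursive_n_rec_binary:
  assumes "recursive_n 1 (\<lambda>xs. a (xs ! 0))" "recursive_n 3 (\<lambda>xs. G (xs ! 0) (xs ! 1) (xs ! 2))"
  shows "recursive_n 2 (\<lambda>xs. rec_nat (a (xs ! 1)) (\<lambda>m r. G (xs ! 1) m r) (xs ! 0))"
proof -
  have "recursive_n (Suc (Suc 1)) (\<lambda>xs. G (xs ! 2) (xs ! 1) (xs ! 0))"
    using recursive_n_comp[of "[\<lambda>xs. xs ! 2, \<lambda>xs. xs ! 1, \<lambda>xs. xs ! 0]" 3 "\<lambda>xs. G (xs ! 0) (xs ! 1) (xs ! 2)"]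
      assms(2) by (simp add: recursive_n_proj numeral_3_eq_3)
  from recursive_n_prim[OF assms(1) this]
  have "recursive_n 2 (\<lambda>xs. rec_nat (a (tl xs ! 0)) (\<lambda>m r. G (tl xs ! 0) m r) (hd xs))"
    by (simp add: numeral_2_eq_2)
  then show ?thesis
  proof (rule recursive_n_cong)
    fix xs :: "nat list" assume "length xs = 2"
    then have "hd xs = xs ! 0" "tl xs ! 0 = xs ! 1" by (cases xs; simp add: nth_tl)+
    then show "rec_nat (a (tl xs ! 0)) (\<lambda>m r. G (tl xs ! 0) m r) (hd xs)
      = rec_nat (a (xs ! 1)) (\<lambda>m r. G (xs ! 1) m r) (xs ! 0)" by (simp only:)
  qed
qed

section \<open>Arithmetic by primitive recursion\<close>

lemma recursive_n_add_base: "recursive_n 2 (\<lambda>xs. xs ! 0 + xs ! 1)"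
proof -
  have eq: "rec_nat y (\<lambda>m r. Suc r) x = x + y" for x y :: nat by (induction x) auto
  have "recursive_n 2 (\<lambda>xs. rec_nat (xs ! 1) (\<lambda>m r. Suc r) (xs ! 0))"
    by (rule recursive_n_rec_binary) (intro recursive_n_Suc recursive_n_proj; simp)+
  then show ?thesis by (simp only: eq)
qed

lemmas recursive_n_add = recursive_n_comp2[OF recursive_n_add_base]

lemma recursive_n_pred_base: "recursive_n 1 (\<lambda>xs. xs ! 0 - 1)"
proof -
  have eq: "rec_nat 0 (\<lambda>m r. m) x = x - 1" for x :: nat by (cases x) auto
  have "recursive_n 1 (\<lambda>xs. rec_nat 0 (\<lambda>m r. m) (xs ! 0))"
    by (rule recursive_n_rec_unary) (intro recursive_n_proj; simp)
  then show ?thesis by (simp only: eq)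
qed

lemma recursive_n_diff:
  assumes "recursive_n n A" "recursive_n n B"
  shows "recursive_n n (\<lambda>xs. A xs - B xs)"
proof -
  have eq: "rec_nat y (\<lambda>m r. r - 1) x = y - x" for x y :: nat by (induction x) auto
  have "recursive_n 2 (\<lambda>xs. rec_nat (xs ! 1) (\<lambda>m r. r - 1) (xs ! 0))"
    by (rule recursive_n_rec_binary) (intro recursive_n_comp1[OF recursive_n_pred_base] recursive_n_proj; simp)+
  then have "recursive_n 2 (\<lambda>xs. xs ! 1 - xs ! 0)" by (simp only: eq)
  from recursive_n_comp2[OF this assms(2,1)] show ?thesis .
qed

lemma recursive_n_mult_base: "recursive_n 2 (\<lambda>xs. xs ! 0 * xs ! 1)"
proof -
  have eq: "rec_nat 0 (\<lambda>m r. r + y) x = x * y" for x y :: nat by (induction x) auto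
  have "recursive_n 2 (\<lambda>xs. rec_nat 0 (\<lambda>m r. r + xs ! 1) (xs ! 0))"
    by (rule recursive_n_rec_binary) (intro recursive_n_const recursive_n_add recursive_n_proj; simp)+
  then show ?thesis by (simp only: eq)
qed

lemma recursive_n_triangle_base: "recursive_n 1 (\<lambda>xs. triangle (xs ! 0))"
proof -
  have eq: "rec_nat 0 (\<lambda>m r. r + Suc m) x = triangle x" for x :: nat by (induction x) auto
  have "recursive_n 1 (\<lambda>xs. rec_nat 0 (\<lambda>m r. r + Suc m) (xs ! 0))"
    by (rule recursive_n_rec_unary) (intro recursive_n_Suc recursive_n_add recursive_n_proj; simp)
  then show ?thesis by (simp only: eq)
qed

section \<open>The Cantor pairing and its inverses\<close>

definition pair :: "nat \<Rightarrow> nat \<Rightarrow> nat" where "pair x y = prod_encode (x, y)"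
definition pfst :: "nat \<Rightarrow> nat" where "pfst z = fst (prod_decode z)"
definition psnd :: "nat \<Rightarrow> nat" where "psnd z = snd (prod_decode z)"

lemma pfst_pair [simp]: "pfst (pair x y) = x" and psnd_pair [simp]: "psnd (pair x y) = y"
  and pair_pfst_psnd [simp]: "pair (pfst z) (psnd z) = z"
  by (simp_all add: pair_def pfst_def psnd_def)

lemma recursive_n_pair_base: "recursive_n 2 (\<lambda>xs. pair (xs ! 0) (xs ! 1))"
  unfolding pair_def prod_encode_def prod.case
  by (intro recursive_n_add recursive_n_comp1[OF recursive_n_triangle_base] recursive_n_proj) simp_all

lemma triangle_mono: "m \<le> n \<Longrightarrow> triangle m \<le> triangle n"
  by (induction n) (auto simp: le_Suc_eq)

lemma triangle_pfst_psnd: "triangle (pfst z + psnd z) + pfst z = z"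
  using pair_pfst_psnd[of z] by (simp only: pair_def prod_encode_def prod.case)

text \<open>The code \<open>z\<close> lies on the antidiagonal with sum \<open>k\<close> exactly
  when \<open>triangle k \<le> z < triangle (Suc k)\<close>. The truncated difference vanishes as
  soon as the second inequality holds, so minimization finds the antidiagonal, from which both
  components are computed.\<close>

lemma triangle_root:
  "(LEAST k. Suc z - triangle (Suc k) = 0) = pfst z + psnd z"
proof (rule Least_equality)
  note z = triangle_pfst_psnd[of z]
  show "Suc z - triangle (Suc (pfst z + psnd z)) = 0" using z by (simp only: triangle_Suc)
  fix k assume k: "Suc z - triangle (Suc k) = 0"
  show "pfst z + psnd z \<le> k"
  proof (rule ccontr)
    assume "\<not> ?thesis"
    then have "triangle (Suc k) \<le> triangle (pfst z + psnd z)" by (intro triangle_mono) simp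
    then show False using k z by simp
  qed
qed

lemma recursive_n_pfst_psnd_base:
  "recursive_n 1 (\<lambda>xs. pfst (xs ! 0))" "recursive_n 1 (\<lambda>xs. psnd (xs ! 0))"
proof -
  have "recursive_n 1 (\<lambda>xs. LEAST k. (\<lambda>xs. Suc (xs ! 1) - triangle (Suc (xs ! 0))) (k # xs) = 0)"
  proof (rule recursive_n_Least)
    show "recursive_n (Suc 1) (\<lambda>xs. Suc (xs ! 1) - triangle (Suc (xs ! 0)))"
      by (intro recursive_n_diff recursive_n_Suc recursive_n_comp1[OF recursive_n_triangle_base] recursive_n_proj) simp_all
    show "\<exists>m. Suc ((m # xs) ! 1) - triangle (Suc ((m # xs) ! 0)) = 0" for xs
      by (rule exI[of _ "xs ! 0"]) simp
  qed
  then have root: "recursive_n 1 (\<lambda>xs. pfst (xs ! 0) + psnd (xs ! 0))"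
    by (rule recursive_n_cong) (simp add: triangle_root[symmetric])
  have "recursive_n 1 (\<lambda>xs. xs ! 0 - triangle (pfst (xs ! 0) + psnd (xs ! 0)))"
    by (intro recursive_n_diff recursive_n_comp1[OF recursive_n_triangle_base] recursive_n_proj root) simp
  moreover have "z - triangle (pfst z + psnd z) = pfst z" for z
    using triangle_pfst_psnd[of z] by linarith
  ultimately show 1: "recursive_n 1 (\<lambda>xs. pfst (xs ! 0))" by simp
  show "recursive_n 1 (\<lambda>xs. psnd (xs ! 0))"
    using recursive_n_diff[OF root 1] by simp
qed

text \<open>Functions are unary; further arguments and bound variables are passed through
  \<^const>\<open>pair\<close>, which keeps the closure rules below directed by the syntax of the body.\<close>

definition recursive :: "(nat \<Rightarrow> nat) \<Rightarrow> bool" where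
  "recursive f \<longleftrightarrow> (\<exists>r. \<forall>x. eval r [x] (f x))"

lemma recursive_iff_recursive_n: "recursive f \<longleftrightarrow> recursive_n 1 (\<lambda>xs. f (xs ! 0))"
proof -
  have "(\<forall>xs. length xs = 1 \<longrightarrow> eval r xs (f (xs ! 0))) \<longleftrightarrow> (\<forall>x. eval r [x] (f x))" for r
  proof (intro iffI allI impI)
    show "eval r [x] (f x)" if "\<forall>xs. length xs = 1 \<longrightarrow> eval r xs (f (xs ! 0))" for x
      using that[rule_format, of "[x]"] by simp
    show "eval r xs (f (xs ! 0))" if *: "\<forall>x. eval r [x] (f x)" and "length xs = 1" for xs
    proof -
      from \<open>length xs = 1\<close> obtain x where "xs = [x]" by (cases xs) auto
      then show ?thesis using * by simp
    qed
  qed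
  then show ?thesis unfolding recursive_def recursive_n_def by simp
qed

named_theorems recursive_intros

lemma recursive_comp: "recursive F \<Longrightarrow> recursive f \<Longrightarrow> recursive (\<lambda>x. F (f x))"
  unfolding recursive_iff_recursive_n by (rule recursive_n_comp1)

lemma recursive_comp_binary:
  "recursive_n 2 (\<lambda>xs. G (xs ! 0) (xs ! 1)) \<Longrightarrow> recursive f \<Longrightarrow> recursive g \<Longrightarrow> recursive (\<lambda>x. G (f x) (g x))"
  unfolding recursive_iff_recursive_n by (rule recursive_n_comp2)

lemma recursive_id [recursive_intros]: "recursive (\<lambda>x. x)"
  unfolding recursive_iff_recursive_n by (rule recursive_n_proj) simp

lemma recursive_const [recursive_intros]: "recursive (\<lambda>_. c)"
  unfolding recursive_iff_recursive_n by (rule recursive_n_const)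

lemma recursive_Suc [recursive_intros]: "recursive f \<Longrightarrow> recursive (\<lambda>x. Suc (f x))"
  unfolding recursive_iff_recursive_n by (rule recursive_n_Suc)

lemmas recursive_add [recursive_intros] = recursive_comp_binary[OF recursive_n_add_base]
lemmas recursive_mult [recursive_intros] = recursive_comp_binary[OF recursive_n_mult_base]
lemmas recursive_pair [recursive_intros] = recursive_comp_binary[OF recursive_n_pair_base]

lemma recursive_diff [recursive_intros]: "recursive f \<Longrightarrow> recursive g \<Longrightarrow> recursive (\<lambda>x. f x - g x)"
  unfolding recursive_iff_recursive_n by (rule recursive_n_diff)

lemma recursive_pfst [recursive_intros]: "recursive f \<Longrightarrow> recursive (\<lambda>x. pfst (f x))"
  and recursive_psnd [recursive_intros]: "recursive f \<Longrightarrow> recursive (\<lambda>x. psnd (f x))"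
  using recursive_comp[of pfst f] recursive_comp[of psnd f]
  by (simp_all add: recursive_iff_recursive_n[of pfst] recursive_iff_recursive_n[of psnd]
      recursive_n_pfst_psnd_base[unfolded One_nat_def])

lemma recursive_rec_nat [recursive_intros]:
  assumes "recursive a" "recursive m" "recursive (\<lambda>z. G (pfst z) (pfst (psnd z)) (psnd (psnd z)))"
  shows "recursive (\<lambda>x. rec_nat (a x) (\<lambda>n r. G x n r) (m x))"
proof -
  have "recursive_n 3 (\<lambda>xs. (\<lambda>z. G (pfst z) (pfst (psnd z)) (psnd (psnd z)))
      (pair (xs ! 0) (pair (xs ! 1) (xs ! 2))))"
    by (rule recursive_n_comp1[OF assms(3)[unfolded recursive_iff_recursive_n]])
      (intro recursive_n_comp2[OF recursive_n_pair_base] recursive_n_proj; simp)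
  then have "recursive_n 3 (\<lambda>xs. G (xs ! 0) (xs ! 1) (xs ! 2))" by simp
  from recursive_n_rec_binary[OF assms(1)[unfolded recursive_iff_recursive_n] this]
  have "recursive_n 2 (\<lambda>xs. (\<lambda>i x. rec_nat (a x) (\<lambda>n r. G x n r) i) (xs ! 0) (xs ! 1))" .
  from recursive_comp_binary[OF this assms(2) recursive_id] show ?thesis .
qed

section \<open>Decidable predicates and bounded quantifiers\<close>

definition decidable :: "(nat \<Rightarrow> bool) \<Rightarrow> bool" where
  "decidable P \<longleftrightarrow> recursive (\<lambda>x. of_bool (P x))"

lemma decidable_eq_0: "recursive f \<Longrightarrow> decidable (\<lambda>x. f x = 0)"
proof -
  assume "recursive f"
  then have "recursive (\<lambda>x. 1 - f x)" by (intro recursive_intros)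
  moreover have "(\<lambda>x. 1 - f x) = (\<lambda>x. of_bool (f x = 0))" by auto
  ultimately show ?thesis unfolding decidable_def by (simp only:)
qed

lemma decidable_not [recursive_intros]: "decidable P \<Longrightarrow> decidable (\<lambda>x. \<not> P x)"
  using decidable_eq_0[of "\<lambda>x. of_bool (P x)"] by (simp add: decidable_def)

lemma decidable_conj [recursive_intros]: "decidable P \<Longrightarrow> decidable Q \<Longrightarrow> decidable (\<lambda>x. P x \<and> Q x)"
  unfolding decidable_def of_bool_conj by (rule recursive_mult)

lemma decidable_disj [recursive_intros]: "decidable P \<Longrightarrow> decidable Q \<Longrightarrow> decidable (\<lambda>x. P x \<or> Q x)"
  using decidable_not[OF decidable_conj[OF decidable_not decidable_not], of P Q] by simp

lemma decidable_le [recursive_intros]: "recursive f \<Longrightarrow> recursive g \<Longrightarrow> decidable (\<lambda>x. f x \<le> g x)"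
  using decidable_eq_0[OF recursive_diff, of f g] by simp

lemma decidable_less [recursive_intros]: "recursive f \<Longrightarrow> recursive g \<Longrightarrow> decidable (\<lambda>x. f x < g x)"
  using decidable_not[OF decidable_le[of g f]] by (simp add: not_le)

lemma decidable_eq [recursive_intros]: "recursive f \<Longrightarrow> recursive g \<Longrightarrow> decidable (\<lambda>x. f x = g x)"
  unfolding order.eq_iff by (intro recursive_intros)

lemma decidable_comp: "decidable P \<Longrightarrow> recursive f \<Longrightarrow> decidable (\<lambda>x. P (f x))"
  unfolding decidable_def by (rule recursive_comp)

lemma recursive_if [recursive_intros]:
  assumes "decidable P" "recursive f" "recursive g"
  shows "recursive (\<lambda>x. if P x then f x else g x)"
proof -
  have eq: "of_bool b * m + (1 - of_bool b) * n = (if b then m else n)" for b and m n :: nat by (cases b) simp_all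
  have "recursive (\<lambda>x. of_bool (P x) * f x + (1 - of_bool (P x)) * g x)"
    by (intro recursive_intros assms assms(1)[unfolded decidable_def])
  then show ?thesis by (simp only: eq)
qed

lemma recursive_sum [recursive_intros]:
  assumes "recursive m" "recursive (\<lambda>z. f (pfst z) (psnd z))"
  shows "recursive (\<lambda>x. \<Sum>i<m x. f x i)"
proof -
  have eq: "rec_nat 0 (\<lambda>n r. r + g n) k = (\<Sum>i<k. g i)" for g :: "nat \<Rightarrow> nat" and k
    by (induction k) auto
  have "recursive (\<lambda>z. (\<lambda>z. f (pfst z) (psnd z)) (pair (pfst z) (pfst (psnd z))))"
    by (rule recursive_comp[OF assms(2)]) (intro recursive_intros)
  then have "recursive (\<lambda>z. f (pfst z) (pfst (psnd z)))" by (simp only: pfst_pair psnd_pair)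
  then have "recursive (\<lambda>x. rec_nat 0 (\<lambda>n r. r + f x n) (m x))"
    by (intro recursive_intros assms)
  then show ?thesis by (simp only: eq)
qed

lemma recursive_power [recursive_intros]:
  assumes "recursive f" "recursive g"
  shows "recursive (\<lambda>x. f x ^ g x)"
proof -
  have eq: "rec_nat 1 (\<lambda>n r. a * r) k = a ^ k" for a :: nat and k
    by (induction k) auto
  have "recursive (\<lambda>x. rec_nat 1 (\<lambda>n r. f x * r) (g x))"
    by (intro recursive_intros assms recursive_comp[OF assms(1)])
  then show ?thesis by (simp only: eq)
qed

lemma decidable_bex [recursive_intros]:
  assumes "recursive m" "decidable (\<lambda>z. P (pfst z) (psnd z))"
  shows "decidable (\<lambda>x. \<exists>i<m x. P x i)"
proof -
  have "decidable (\<lambda>x. \<not> (\<Sum>i<m x. of_bool (P x i)) = (0::nat))"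
    using assms unfolding decidable_def[of "\<lambda>z. P (pfst z) (psnd z)"]
    by (intro recursive_intros)
  then show ?thesis by (rule back_subst[of decidable]) (auto intro!: ext)
qed

lemma decidable_ball [recursive_intros]:
  assumes "recursive m" "decidable (\<lambda>z. P (pfst z) (psnd z))"
  shows "decidable (\<lambda>x. \<forall>i<m x. P x i)"
  using decidable_not[OF decidable_bex[OF assms(1) decidable_not[OF assms(2)]]] by simp

lemma recursive_Least:
  assumes "decidable (\<lambda>z. P (pfst z) (psnd z))" "\<And>x. \<exists>n. P x n"
  shows "recursive (\<lambda>x. LEAST n. P x n)"
proof -
  have "recursive (\<lambda>z. of_bool (\<not> P (pfst z) (psnd z)))"
    using decidable_not[OF assms(1)] unfolding decidable_def .
  then have "recursive_n 2 (\<lambda>xs. (\<lambda>z. of_bool (\<not> P (pfst z) (psnd z))) (pair (xs ! 1) (xs ! 0)))"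
    unfolding recursive_iff_recursive_n
    by (rule recursive_n_comp1) (intro recursive_n_comp2[OF recursive_n_pair_base] recursive_n_proj; simp)
  then have "recursive_n (Suc 1) (\<lambda>xs. of_bool (\<not> P (xs ! 1) (xs ! 0)))"
    by (simp add: numeral_2_eq_2)
  then have "recursive_n 1 (\<lambda>xs. LEAST m. (\<lambda>xs. of_bool (\<not> P (xs ! 1) (xs ! 0))) (m # xs) = (0::nat))"
    by (rule recursive_n_Least) (use assms(2) in auto)
  then show ?thesis by (simp add: recursive_iff_recursive_n)
qed

lemma recursive_div [recursive_intros]:
  assumes "recursive f" "recursive g"
  shows "recursive (\<lambda>x. f x div g x)"
proof -
  \<comment> \<open>The disjunct \<open>psnd z = 0\<close> makes the search total; it then stops at
    0, the value of a division by 0.\<close>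
  have "recursive (\<lambda>z. LEAST k. psnd z = 0 \<or> pfst z < Suc k * psnd z)"
  proof (rule recursive_Least)
    show "decidable (\<lambda>w. psnd (pfst w) = 0 \<or> pfst (pfst w) < Suc (psnd w) * psnd (pfst w))"
      by (intro recursive_intros)
    show "\<exists>n. psnd x = 0 \<or> pfst x < Suc n * psnd x" for x
      by (rule exI[of _ "pfst x"]) (cases "psnd x", auto)
  qed
  moreover have "(LEAST k. b = 0 \<or> a < Suc k * b) = a div b" for a b :: nat
  proof (cases "b = 0")
    case False
    show ?thesis
    proof (rule Least_equality)
      show "b = 0 \<or> a < Suc (a div b) * b" using False
        by (metis dividend_less_div_times mult_Suc add.commute neq0_conv)
      fix k assume "b = 0 \<or> a < Suc k * b"
      then show "a div b \<le> k" using False by (metis less_Suc_eq_le less_mult_imp_div_less)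
    qed
  qed simp
  ultimately have "recursive (\<lambda>z. pfst z div psnd z)" by simp
  then have "recursive (\<lambda>x. (\<lambda>z. pfst z div psnd z) (pair (f x) (g x)))"
    by (rule recursive_comp) (intro recursive_intros assms)
  then show ?thesis by simp
qed

lemma recursive_mod [recursive_intros]:
  "recursive f \<Longrightarrow> recursive g \<Longrightarrow> recursive (\<lambda>x. f x mod g x)"
  unfolding modulo_nat_def by (intro recursive_intros)

lemma decidable_even [recursive_intros]: "recursive f \<Longrightarrow> decidable (\<lambda>x. even (f x))"
  unfolding even_iff_mod_2_eq_zero by (intro recursive_intros)

section \<open>Semidecidable predicates\<close>

text \<open>The projection form, rather than the domain of some \<open>recf\<close>, reduces closure
  under connectives and quantifiers to a rearrangement of witnesses.\<close>

definition semidecidable :: "(nat \<Rightarrow> bool) \<Rightarrow> bool" where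
  "semidecidable P \<longleftrightarrow> (\<exists>Q. decidable Q \<and> (\<forall>x. P x \<longleftrightarrow> (\<exists>t. Q (pair x t))))"

named_theorems semidecidable_intros

lemma semidecidable_decidable: "decidable P \<Longrightarrow> semidecidable P"
  unfolding semidecidable_def
  by (rule exI[of _ "\<lambda>z. P (pfst z)"]) (simp add: decidable_comp recursive_pfst recursive_id)

lemma semidecidable_comp:
  assumes "semidecidable P" "recursive f"
  shows "semidecidable (\<lambda>x. P (f x))"
proof -
  from assms(1) obtain Q where Q: "decidable Q" "\<And>x. P x \<longleftrightarrow> (\<exists>t. Q (pair x t))"
    unfolding semidecidable_def by blast
  have "decidable (\<lambda>z. Q (pair (f (pfst z)) (psnd z)))"
    by (intro decidable_comp[OF Q(1)] recursive_intros recursive_comp[OF assms(2)])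
  then show ?thesis unfolding semidecidable_def
    by (intro exI[of _ "\<lambda>z. Q (pair (f (pfst z)) (psnd z))"]) (simp add: Q(2))
qed

lemma semidecidable_comp2:
  assumes "semidecidable (\<lambda>z. P (pfst z) (psnd z))" "recursive f" "recursive g"
  shows "semidecidable (\<lambda>x. P (f x) (g x))"
  using semidecidable_comp[OF assms(1) recursive_pair[OF assms(2,3)]] by simp

lemma semidecidable_ex [semidecidable_intros]:
  assumes "semidecidable (\<lambda>z. P (pfst z) (psnd z))"
  shows "semidecidable (\<lambda>x. \<exists>y. P x y)"
proof -
  from assms obtain Q where Q: "decidable Q" "\<And>z. P (pfst z) (psnd z) \<longleftrightarrow> (\<exists>t. Q (pair z t))"
    unfolding semidecidable_def by blast
  let ?Q = "\<lambda>z. Q (pair (pair (pfst z) (pfst (psnd z))) (psnd (psnd z)))"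
  have "decidable ?Q" by (intro decidable_comp[OF Q(1)] recursive_intros)
  moreover have "(\<exists>y. P x y) \<longleftrightarrow> (\<exists>t. ?Q (pair x t))" for x
  proof
    assume "\<exists>y. P x y"
    then obtain y t where "Q (pair (pair x y) t)" using Q(2)[of "pair x _"] by auto
    then show "\<exists>t. ?Q (pair x t)" by (intro exI[of _ "pair y t"]) simp
  next
    assume "\<exists>t. ?Q (pair x t)"
    then obtain t where "Q (pair (pair x (pfst t)) (psnd t))" by auto
    then show "\<exists>y. P x y" using Q(2)[of "pair x (pfst t)"] by auto
  qed
  ultimately show ?thesis unfolding semidecidable_def by (intro exI[of _ ?Q]) blast
qed

lemma semidecidable_conj [semidecidable_intros]:
  assumes "semidecidable P" "semidecidable P'"
  shows "semidecidable (\<lambda>x. P x \<and> P' x)"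
proof -
  from assms obtain Q Q' where Q: "decidable Q" "\<And>x. P x \<longleftrightarrow> (\<exists>t. Q (pair x t))"
    and Q': "decidable Q'" "\<And>x. P' x \<longleftrightarrow> (\<exists>t. Q' (pair x t))"
    unfolding semidecidable_def by metis
  have "semidecidable (\<lambda>x. \<exists>s. Q (pair x (pfst s)) \<and> Q' (pair x (psnd s)))"
    by (intro semidecidable_ex semidecidable_decidable decidable_conj
        decidable_comp[OF Q(1)] decidable_comp[OF Q'(1)] recursive_intros)
  moreover have "(\<exists>s. Q (pair x (pfst s)) \<and> Q' (pair x (psnd s))) \<longleftrightarrow> P x \<and> P' x" for x
    unfolding Q(2) Q'(2) by (metis pfst_pair psnd_pair)
  ultimately show ?thesis by (simp only:)
qed

lemma semidecidable_disj [semidecidable_intros]: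
  assumes "semidecidable P" "semidecidable P'"
  shows "semidecidable (\<lambda>x. P x \<or> P' x)"
proof -
  from assms obtain Q Q' where Q: "decidable Q" "\<And>x. P x \<longleftrightarrow> (\<exists>t. Q (pair x t))"
    and Q': "decidable Q'" "\<And>x. P' x \<longleftrightarrow> (\<exists>t. Q' (pair x t))"
    unfolding semidecidable_def by metis
  have "semidecidable (\<lambda>x. \<exists>s. Q (pair x s) \<or> Q' (pair x s))"
    by (intro semidecidable_ex semidecidable_decidable decidable_disj
        decidable_comp[OF Q(1)] decidable_comp[OF Q'(1)] recursive_intros)
  moreover have "(\<exists>s. Q (pair x s) \<or> Q' (pair x s)) \<longleftrightarrow> P x \<or> P' x" for x
    unfolding Q(2) Q'(2) by blast
  ultimately show ?thesis by (simp only:)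
qed

lemma semidecidable_ball [semidecidable_intros]:
  assumes "recursive m" "semidecidable (\<lambda>z. P (pfst z) (psnd z))"
  shows "semidecidable (\<lambda>x. \<forall>i<m x. P x i)"
proof -
  from assms obtain Q where Q: "decidable Q" "\<And>z. P (pfst z) (psnd z) \<longleftrightarrow> (\<exists>t. Q (pair z t))"
    unfolding semidecidable_def by blast
  have Qp: "P x i \<longleftrightarrow> (\<exists>t. Q (pair (pair x i) t))" for x i using Q(2)[of "pair x i"] by simp
  \<comment> \<open>Finitely many witnesses have a common bound \<open>s\<close>, for instance their
    sum plus 1; everything below the quantifier over \<open>s\<close> is then decidable.\<close>
  have "semidecidable (\<lambda>x. \<exists>s. \<forall>i<m x. \<exists>t<s. Q (pair (pair x i) t))"
    by (intro semidecidable_ex semidecidable_decidable decidable_ball decidable_bex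
        decidable_comp[OF Q(1)] recursive_intros recursive_comp[OF assms(1)])
  moreover have "(\<exists>s. \<forall>i<m x. \<exists>t<s. Q (pair (pair x i) t)) \<longleftrightarrow> (\<forall>i<m x. P x i)" for x
  proof
    assume "\<forall>i<m x. P x i"
    then obtain t where t: "\<And>i. i < m x \<Longrightarrow> Q (pair (pair x i) (t i))" unfolding Qp by metis
    have "t i < Suc (\<Sum>j<m x. t j)" if "i < m x" for i
      using member_le_sum[of i "{..<m x}" t] that by simp
    with t show "\<exists>s. \<forall>i<m x. \<exists>t<s. Q (pair (pair x i) t)" by blast
  qed (use Qp in blast)
  ultimately show ?thesis by (simp only:)
qed

text \<open>The search runs through pairs of a candidate value and a witness and returns the value
  in the first success. For relations with several solutions this is an effective choice, which
  later selects numerical approximations and, in the randomness proof, an unlisted string.\<close>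

lemma semidecidable_uniformization:
  assumes "semidecidable (\<lambda>z. R (pfst z) (psnd z))"
  obtains r where "\<And>x y. eval r [x] y \<Longrightarrow> R x y" "\<And>x y. R x y \<Longrightarrow> \<exists>y'. eval r [x] y'"
proof -
  from assms obtain Q where Q: "decidable Q" "\<And>z. R (pfst z) (psnd z) \<longleftrightarrow> (\<exists>t. Q (pair z t))"
    unfolding semidecidable_def by blast
  define S where "S x w \<longleftrightarrow> Q (pair (pair x (pfst w)) (psnd w))" for x w
  have "recursive (\<lambda>z. of_bool (\<not> S (pfst z) (psnd z)))"
    unfolding S_def decidable_def[symmetric]
    by (intro decidable_not decidable_comp[OF Q(1)] recursive_intros)
  then have "recursive_n 2 (\<lambda>xs. (\<lambda>z. of_bool (\<not> S (pfst z) (psnd z))) (pair (xs ! 1) (xs ! 0)))"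
    unfolding recursive_iff_recursive_n
    by (rule recursive_n_comp1) (intro recursive_n_comp2[OF recursive_n_pair_base] recursive_n_proj; simp)
  then have "recursive_n 2 (\<lambda>xs. of_bool (\<not> S (xs ! 1) (xs ! 0)))" by simp
  then obtain q where "\<And>xs. length xs = 2 \<Longrightarrow> eval q xs (of_bool (\<not> S (xs ! 1) (xs ! 0)))"
    unfolding recursive_n_def by blast
  then have q: "eval q [w, x] (of_bool (\<not> S x w))" for x w by (metis length_Cons list.size(3) nth_Cons_0
      nth_Cons_Suc numeral_2_eq_2 One_nat_def)
  obtain f where f: "\<And>x. eval f [x] (pfst x)"
    using recursive_pfst[OF recursive_id] unfolding recursive_def by blast
  define r where "r = Comp f [Mn q]"
  show thesis
  proof (rule that[of r])
    fix x y assume "eval r [x] y"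
    then obtain ws where ws: "length ws = 1" "\<forall>i<1. eval ([Mn q] ! i) [x] (ws ! i)" "eval f ws y"
      unfolding r_def by (elim eval_CompE) simp
    obtain w where w: "ws = [w]" using ws(1) by (cases ws) auto
    from ws(2) w have "eval (Mn q) [x] w" by simp
    then have "eval q [w, x] 0" by (rule eval_MnE)
    then have "S x w" using eval_deterministic[OF q] by fastforce
    moreover have "y = pfst w" using ws(3) w f eval_deterministic by blast
    ultimately show "R x y" unfolding S_def using Q(2)[of "pair x y"] by auto
  next
    fix x y assume "R x y"
    then obtain t where "Q (pair (pair x y) t)" using Q(2)[of "pair x y"] by auto
    then have "S x (pair y t)" unfolding S_def by simp
    then have L: "S x (LEAST w. S x w)" by (rule LeastI)
    have "eval (Mn q) [x] (LEAST w. S x w)"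
    proof (rule eval_Mn)
      show "eval q [LEAST w. S x w, x] 0" using q[of "LEAST w. S x w" x] L by simp
      show "\<forall>m<LEAST w. S x w. \<exists>y. y \<noteq> 0 \<and> eval q [m, x] y"
      proof (intro allI impI exI conjI)
        fix m assume "m < (LEAST w. S x w)"
        then have "\<not> S x m" by (rule not_less_Least)
        then show "eval q [m, x] 1" using q[of m x] by simp
      qed simp
    qed
    then have "eval r [x] (pfst (LEAST w. S x w))" unfolding r_def
      by (intro eval_Comp[where ys = "[LEAST w. S x w]"]) (use f in auto)
    then show "\<exists>y'. eval r [x] y'" by blast
  qed
qed

lemma semidecidable_total_choice:
  assumes "semidecidable (\<lambda>z. R (pfst z) (psnd z))" "\<And>x. \<exists>y. R x y"
  obtains f where "recursive f" "\<And>x. R x (f x)"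
proof -
  obtain r where r: "\<And>x y. eval r [x] y \<Longrightarrow> R x y" "\<And>x y. R x y \<Longrightarrow> \<exists>y'. eval r [x] y'"
    using semidecidable_uniformization[OF assms(1)] by metis
  then obtain f where "\<And>x. eval r [x] (f x)" using assms(2) by metis
  with r(1) that show thesis unfolding recursive_def by blast
qed

text \<open>Stage \<open>t\<close> is read as a pair of a candidate and a witness. A candidate is
  listed only at the first stage that succeeds for it, which excludes repetitions.\<close>

lemma semidecidable_enumeration:
  assumes "semidecidable P"
  obtains g where "recursive g" "\<And>t s. g t = Suc s \<Longrightarrow> P s" "\<And>s. P s \<Longrightarrow> \<exists>t. g t = Suc s"
    "\<And>t t' s. g t = Suc s \<Longrightarrow> g t' = Suc s \<Longrightarrow> t = t'"
proof -
  from assms obtain Q where Q: "decidable Q" "\<And>x. P x \<longleftrightarrow> (\<exists>t. Q (pair x t))"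
    unfolding semidecidable_def by blast
  define g where "g t = (if Q t \<and> (\<forall>t'<t. \<not> (Q t' \<and> pfst t' = pfst t)) then Suc (pfst t) else 0)" for t
  have g: "g t = Suc s \<longleftrightarrow> Q t \<and> pfst t = s \<and> (\<forall>t'<t. \<not> (Q t' \<and> pfst t' = s))" for t s
    by (auto simp: g_def)
  show thesis
  proof (rule that[of g])
    show "recursive g" unfolding g_def
      by (intro recursive_intros decidable_comp[OF Q(1)])
    show "P s" if "g t = Suc s" for t s using that unfolding g by (metis Q(2) pair_pfst_psnd)
    show "\<exists>t. g t = Suc s" if "P s" for s
    proof -
      have "\<exists>t. Q t \<and> pfst t = s" using that Q(2) by (metis pfst_pair)
      then show ?thesis unfolding g using exists_least_iff[of "\<lambda>t. Q t \<and> pfst t = s"] by metis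
    qed
    show "t = t'" if "g t = Suc s" "g t' = Suc s" for t t' s
      using that unfolding g by (metis nat_neq_iff)
  qed
qed

section \<open>The graph of a partial recursive function is semidecidable\<close>

definition code_cons :: "nat \<Rightarrow> nat \<Rightarrow> nat" where "code_cons x c = Suc (pair x c)"
definition code_hd :: "nat \<Rightarrow> nat" where "code_hd c = pfst (c - 1)"
definition code_tl :: "nat \<Rightarrow> nat" where "code_tl c = psnd (c - 1)"
definition code_drop :: "nat \<Rightarrow> nat \<Rightarrow> nat" where "code_drop i c = rec_nat c (\<lambda>_. code_tl) i"

lemma code_drop_simps [simp]: "code_drop 0 c = c" "code_drop (Suc i) c = code_tl (code_drop i c)"
  by (simp_all add: code_drop_def)

lemma list_decode_code_cons [simp]: "list_decode (code_cons x c) = x # list_decode c"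
  by (simp add: code_cons_def pair_def)

lemma code_cons_hd_tl: "c \<noteq> 0 \<Longrightarrow> code_cons (code_hd c) (code_tl c) = c"
  by (simp add: code_cons_def code_hd_def code_tl_def)

lemma list_decode_nonzero: "c \<noteq> 0 \<Longrightarrow> list_decode c = code_hd c # list_decode (code_tl c)"
  by (metis code_cons_hd_tl list_decode_code_cons)

text \<open>This default lets \<open>code_drop\<close> run past the end of a list and stay at 0, the
  code of the empty list, in agreement with \<open>drop\<close>.\<close>

lemma code_tl_0 [simp]: "code_tl 0 = 0"
proof -
  have "pair 0 0 = 0" by (simp add: pair_def prod_encode_def)
  then have "psnd 0 = 0" by (metis psnd_pair)
  then show ?thesis by (simp add: code_tl_def)
qed

lemma list_decode_code_tl: "list_decode (code_tl c) = tl (list_decode c)"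
  by (cases "c = 0") (simp_all add: list_decode_nonzero)

lemma list_decode_code_drop: "list_decode (code_drop i c) = drop i (list_decode c)"
  by (induction i) (simp_all add: list_decode_code_tl drop_Suc tl_drop)

lemma list_decode_eq_Nil [simp]: "list_decode c = [] \<longleftrightarrow> c = 0"
  by (cases "c = 0") (simp_all add: list_decode_nonzero)

lemma code_hd_drop: "i < length (list_decode c) \<Longrightarrow> code_hd (code_drop i c) = list_decode c ! i"
proof -
  assume i: "i < length (list_decode c)"
  then have "code_drop i c \<noteq> 0"
    unfolding list_decode_eq_Nil[symmetric] list_decode_code_drop by simp
  from list_decode_nonzero[OF this] show ?thesis
    using i by (simp add: list_decode_code_drop flip: Cons_nth_drop_Suc)
qed

lemma recursive_code [recursive_intros]:
  "recursive f \<Longrightarrow> recursive g \<Longrightarrow> recursive (\<lambda>x. code_cons (f x) (g x))"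
  "recursive f \<Longrightarrow> recursive (\<lambda>x. code_hd (f x))"
  "recursive f \<Longrightarrow> recursive (\<lambda>x. code_tl (f x))"
  unfolding code_cons_def code_hd_def code_tl_def by (intro recursive_intros; assumption)+

lemma recursive_code_drop [recursive_intros]:
  "recursive f \<Longrightarrow> recursive g \<Longrightarrow> recursive (\<lambda>x. code_drop (f x) (g x))"
  unfolding code_drop_def by (intro recursive_intros; assumption)

lemma eval_Comp_iff:
  "eval (Comp f gs) xs y \<longleftrightarrow> (\<exists>c. list_all2 (\<lambda>g. eval g xs) gs (list_decode c) \<and> eval f (list_decode c) y)"
proof
  assume "eval (Comp f gs) xs y"
  then obtain ys where "length ys = length gs" "\<forall>i<length gs. eval (gs ! i) xs (ys ! i)" "eval f ys y"
    by (rule eval_CompE)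
  then show "\<exists>c. list_all2 (\<lambda>g. eval g xs) gs (list_decode c) \<and> eval f (list_decode c) y"
    by (intro exI[of _ "list_encode ys"]) (simp add: list_all2_conv_all_nth)
next
  assume "\<exists>c. list_all2 (\<lambda>g. eval g xs) gs (list_decode c) \<and> eval f (list_decode c) y"
  then show "eval (Comp f gs) xs y" by (auto simp: list_all2_conv_all_nth intro!: eval_Comp)
qed

lemma eval_Prim_iff:
  "eval (Prim f g) (n # xs) y \<longleftrightarrow>
    (\<exists>s. eval f xs (s 0) \<and> (\<forall>i<n. eval g (s i # i # xs) (s (Suc i))) \<and> y = s n)"
proof (induction n arbitrary: y)
  case 0
  show ?case
  proof
    assume "eval (Prim f g) (0 # xs) y"
    then have "eval f xs y" by (rule eval_Prim0E)
    then show "\<exists>s. eval f xs (s 0) \<and> (\<forall>i<0. eval g (s i # i # xs) (s (Suc i))) \<and> y = s 0"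
      by (intro exI[of _ "\<lambda>_. y"]) simp
  qed (auto intro: eval_Prim0)
next
  case (Suc n)
  show ?case
  proof
    assume "eval (Prim f g) (Suc n # xs) y"
    then obtain r where r: "eval (Prim f g) (n # xs) r" "eval g (r # n # xs) y" by (rule eval_PrimSE)
    then obtain s where s: "eval f xs (s 0)" "\<forall>i<n. eval g (s i # i # xs) (s (Suc i))" "r = s n"
      using Suc.IH[of r] by blast
    show "\<exists>s. eval f xs (s 0) \<and> (\<forall>i<Suc n. eval g (s i # i # xs) (s (Suc i))) \<and> y = s (Suc n)"
      by (rule exI[of _ "s(Suc n := y)"]) (use s r(2) in \<open>simp add: less_Suc_eq\<close>)
  next
    assume "\<exists>s. eval f xs (s 0) \<and> (\<forall>i<Suc n. eval g (s i # i # xs) (s (Suc i))) \<and> y = s (Suc n)"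
    then obtain s where s: "eval f xs (s 0)" "\<forall>i<Suc n. eval g (s i # i # xs) (s (Suc i))" "y = s (Suc n)"
      by blast
    then have "eval (Prim f g) (n # xs) (s n)" using Suc.IH[of "s n"] by auto
    then show "eval (Prim f g) (Suc n # xs) y" using s by (auto intro: eval_PrimS)
  qed
qed

text \<open>The intermediate values of the recursion are packed into one list code \<open>c\<close>,
  so that the unbounded quantifier ranges over a number; entry \<open>i\<close> is the value after
  \<open>i\<close> steps.\<close>

lemma eval_Prim_iff_code:
  "eval (Prim f g) (n # xs) y \<longleftrightarrow>
    (\<exists>c. eval f xs (code_hd c) \<and>
      (\<forall>i<n. eval g (code_hd (code_drop i c) # i # xs) (code_hd (code_drop (Suc i) c))) \<and>
      y = code_hd (code_drop n c))"
proof
  assume "eval (Prim f g) (n # xs) y"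
  then obtain s where s: "eval f xs (s 0)" "\<forall>i<n. eval g (s i # i # xs) (s (Suc i))" "y = s n"
    unfolding eval_Prim_iff by blast
  define c where "c = list_encode (map s [0..<Suc n])"
  have c: "code_hd (code_drop i c) = s i" if "i \<le> n" for i
    using code_hd_drop[of i c] that by (simp add: c_def nth_append del: upt_Suc)
  show "\<exists>c. eval f xs (code_hd c) \<and>
      (\<forall>i<n. eval g (code_hd (code_drop i c) # i # xs) (code_hd (code_drop (Suc i) c))) \<and>
      y = code_hd (code_drop n c)"
    using s c[of 0] c by (intro exI[of _ c]) (simp del: code_drop_simps(2))
next
  assume "\<exists>c. eval f xs (code_hd c) \<and>
      (\<forall>i<n. eval g (code_hd (code_drop i c) # i # xs) (code_hd (code_drop (Suc i) c))) \<and>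
      y = code_hd (code_drop n c)"
  then obtain c where "eval f xs (code_hd c)"
      "\<forall>i<n. eval g (code_hd (code_drop i c) # i # xs) (code_hd (code_drop (Suc i) c))"
      "y = code_hd (code_drop n c)" by blast
  then show "eval (Prim f g) (n # xs) y" unfolding eval_Prim_iff
    by (intro exI[of _ "\<lambda>i. code_hd (code_drop i c)"]) simp
qed

lemma eval_Prim_nonempty: "eval (Prim f g) xs y \<Longrightarrow> xs \<noteq> []"
  by (erule eval.cases) auto

lemma eval_Mn_iff:
  "eval (Mn f) xs n \<longleftrightarrow> eval f (n # xs) 0 \<and> (\<forall>m<n. \<exists>y. y \<noteq> 0 \<and> eval f (m # xs) y)"
  by (auto elim: eval_MnE intro: eval_Mn)

text \<open>Induction on \<open>r\<close>: composition and primitive recursion quantify over codes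
  of intermediate values, minimization combines a bounded quantifier with an existential one.
  Passing the arguments as one list code gives subterms of every arity the same induction
  hypothesis.\<close>

lemma semidecidable_eval_list: "semidecidable (\<lambda>z. eval r (list_decode (pfst z)) (psnd z))"
proof (induction r)
  case Zero
  have "eval Zero xs y \<longleftrightarrow> y = 0" for xs y by (auto elim: eval_ZeroE intro: eval_Zero)
  then show ?case by (simp only:) (intro semidecidable_decidable recursive_intros)
next
  case Succ
  have "eval Succ (list_decode c) y \<longleftrightarrow> c \<noteq> 0 \<and> y = Suc (code_hd c)" for c y
    by (cases "c = 0") (auto simp: list_decode_nonzero elim: eval_SuccE intro: eval_Succ)
  then show ?case by (simp only:) (intro semidecidable_decidable recursive_intros)
next
  case (Proj i)
  have "eval (Proj i) xs y \<longleftrightarrow> i < length xs \<and> y = xs ! i" for xs y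
    by (auto elim: eval_ProjE intro: eval_Proj)
  moreover have "code_drop i c \<noteq> 0 \<longleftrightarrow> i < length (list_decode c)" for c
    unfolding list_decode_eq_Nil[symmetric] list_decode_code_drop by (simp add: not_le)
  ultimately have "eval (Proj i) (list_decode c) y \<longleftrightarrow> code_drop i c \<noteq> 0 \<and> y = code_hd (code_drop i c)" for c y
    using code_hd_drop[of i c] by auto
  then show ?case by (simp only:) (intro semidecidable_decidable recursive_intros)
next
  case (Comp f gs)
  have args: "semidecidable (\<lambda>z. list_all2 (\<lambda>g. eval g (list_decode (pfst z))) gs (list_decode (psnd z)))"
    using Comp.IH(2)
  proof (induction gs)
    case Nil
    show ?case by (simp only: list_all2_Nil list_decode_eq_Nil) (intro semidecidable_decidable recursive_intros)
  next
    case (Cons g gs)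
    have "list_all2 P (g # gs) (list_decode c) \<longleftrightarrow>
        c \<noteq> 0 \<and> P g (code_hd c) \<and> list_all2 P gs (list_decode (code_tl c))" for P c
      by (cases "c = 0") (simp_all add: list_decode_nonzero)
    moreover have "semidecidable (\<lambda>z. psnd z \<noteq> 0 \<and> eval g (list_decode (pfst z)) (code_hd (psnd z)) \<and>
        list_all2 (\<lambda>g. eval g (list_decode (pfst z))) gs (list_decode (code_tl (psnd z))))"
    proof (intro semidecidable_conj)
      show "semidecidable (\<lambda>z. psnd z \<noteq> 0)" by (intro semidecidable_decidable recursive_intros)
      show "semidecidable (\<lambda>z. eval g (list_decode (pfst z)) (code_hd (psnd z)))"
        by (rule semidecidable_comp2[OF Cons.prems, of g]) (simp, (intro recursive_intros)+)
      show "semidecidable (\<lambda>z. list_all2 (\<lambda>g. eval g (list_decode (pfst z))) gs (list_decode (code_tl (psnd z))))"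
        by (rule semidecidable_comp2[OF Cons.IH]) (use Cons.prems in simp, (intro recursive_intros)+)
    qed
    ultimately show ?case by (simp only:)
  qed
  have "semidecidable (\<lambda>z. \<exists>c. list_all2 (\<lambda>g. eval g (list_decode (pfst z))) gs (list_decode c)
      \<and> eval f (list_decode c) (psnd z))"
    by (intro semidecidable_intros semidecidable_comp2[OF Comp.IH(1)] semidecidable_comp2[OF args] recursive_intros)
  then show ?case by (simp only: eval_Comp_iff)
next
  case (Prim f g)
  have eq: "eval (Prim f g) (list_decode c) y \<longleftrightarrow> c \<noteq> 0 \<and>
     (\<exists>s. eval f (list_decode (code_tl c)) (code_hd s) \<and>
      (\<forall>i<code_hd c. eval g (list_decode (code_cons (code_hd (code_drop i s)) (code_cons i (code_tl c))))
         (code_hd (code_drop (Suc i) s))) \<and>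
      y = code_hd (code_drop (code_hd c) s))" for c y
  proof (cases "c = 0")
    case True
    then show ?thesis using eval_Prim_nonempty[of f g "[]" y] by auto
  next
    case False
    then show ?thesis
      by (simp add: list_decode_nonzero[OF False] eval_Prim_iff_code del: code_drop_simps(2))
  qed
  show ?case unfolding eq
    by (intro semidecidable_conj semidecidable_ex semidecidable_ball
        semidecidable_comp2[OF Prim.IH(1)] semidecidable_comp2[OF Prim.IH(2)] recursive_intros;
        intro semidecidable_decidable recursive_intros)
next
  case (Mn f)
  have eq: "eval (Mn f) (list_decode c) n \<longleftrightarrow> eval f (list_decode (code_cons n c)) 0 \<and>
      (\<forall>m<n. \<exists>y. y \<noteq> 0 \<and> eval f (list_decode (code_cons m c)) y)" for c n
    by (simp add: eval_Mn_iff)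
  show ?case unfolding eq
    by (intro semidecidable_conj semidecidable_ex semidecidable_ball
        semidecidable_comp2[OF Mn] recursive_intros;
        intro semidecidable_decidable recursive_intros)
qed

lemma semidecidable_eval: "semidecidable (\<lambda>z. eval r [pfst z] (psnd z))"
proof -
  have "semidecidable (\<lambda>z. eval r (list_decode (code_cons (pfst z) 0)) (psnd z))"
    by (intro semidecidable_comp2[OF semidecidable_eval_list] recursive_intros)
  then show ?thesis by simp
qed

section \<open>Codes of binary strings\<close>

lemma str_nat_bounds: "2 ^ length s \<le> Suc (str_nat s)" "Suc (str_nat s) < 2 ^ Suc (length s)"
  by (induction s) auto

lemma inj_str_nat: "str_nat s = str_nat t \<Longrightarrow> s = t"
proof (induction s arbitrary: t)
  case Nil
  then show ?case by (cases t) (auto split: if_splits)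
next
  case (Cons b s)
  obtain b' t' where t: "t = b' # t'" using Cons.prems by (cases t) (auto split: if_splits)
  have "b = b'" using Cons.prems unfolding t by (auto split: if_splits) presburger+
  then show ?case using Cons unfolding t by (auto split: if_splits)
qed

lemma surj_str_nat: "\<exists>s. str_nat s = n"
proof (induction n rule: less_induct)
  case (less n)
  show ?case
  proof (cases n)
    case (Suc m)
    then obtain s where s: "str_nat s = m div 2" using less[of "m div 2"] by (auto simp: less_Suc_eq_le)
    have "str_nat (odd m # s) = n" using Suc s by (simp add: odd_two_times_div_two_nat)
    then show ?thesis by blast
  qed (auto intro: exI[of _ "[]"])
qed

definition str_of :: "nat \<Rightarrow> bool list" where "str_of n = (THE s. str_nat s = n)"

lemma str_of_str_nat [simp]: "str_of (str_nat s) = s"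
  unfolding str_of_def using inj_str_nat by blast

lemma str_nat_str_of [simp]: "str_nat (str_of n) = n"
  using surj_str_nat[of n] by auto

text \<open>The strings of length \<open>n\<close> have the codes from \<open>2 ^ n - 1\<close> to
  \<open>2 ^ Suc n - 2\<close>, so the length can be read off from the size of the code.\<close>

definition code_length :: "nat \<Rightarrow> nat" where "code_length x = (LEAST n. Suc x < 2 ^ Suc n)"

lemma code_length_str_nat [simp]: "code_length (str_nat s) = length s"
  unfolding code_length_def
proof (rule Least_equality)
  fix n assume "Suc (str_nat s) < 2 ^ Suc n"
  then have "(2::nat) ^ length s < 2 ^ Suc n" using str_nat_bounds(1)[of s] by linarith
  then have "length s < Suc n" by (rule power_less_imp_less_exp[of "2::nat", rotated]) simp
  then show "length s \<le> n" by simp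
qed (rule str_nat_bounds(2))

lemma length_str_of: "length (str_of x) = code_length x"
  by (metis code_length_str_nat str_nat_str_of)

lemma recursive_code_length [recursive_intros]:
  assumes "recursive f"
  shows "recursive (\<lambda>x. code_length (f x))"
proof -
  have "recursive code_length" unfolding code_length_def
  proof (rule recursive_Least)
    show "decidable (\<lambda>z. Suc (pfst z) < 2 ^ Suc (psnd z))" by (intro recursive_intros)
    show "\<exists>n. Suc x < 2 ^ Suc n" for x
      using str_nat_bounds(2)[of "str_of x"] by (simp only: str_nat_str_of) blast
  qed
  from recursive_comp[OF this assms] show ?thesis .
qed

section \<open>Binary expansions with the leading bit first\<close>

definition msb_string :: "nat \<Rightarrow> nat \<Rightarrow> bool list" where
  "msb_string n j = map (\<lambda>k. odd (j div 2 ^ (n - Suc k))) [0..<n]"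

text \<open>\<open>str_nat\<close> uses the digits 1 and 2, the first character weighing least. Each
  digit is its bit plus 1, and these ones add up to \<open>2 ^ n - 1\<close>.\<close>

definition msb_code :: "nat \<Rightarrow> nat \<Rightarrow> nat" where
  "msb_code n j = 2 ^ n - 1 + (\<Sum>k<n. (j div 2 ^ (n - Suc k) mod 2) * 2 ^ k)"

lemma length_msb_string [simp]: "length (msb_string n j) = n"
  by (simp add: msb_string_def)

lemma str_nat_snoc: "str_nat (s @ [b]) = str_nat s + 2 ^ length s * (if b then 2 else 1)"
  by (induction s) auto

lemma str_nat_msb_string: "str_nat (msb_string n j) = msb_code n j"
proof -
  have "Suc (str_nat (map f [0..<m])) = 2 ^ m + (\<Sum>k<m. of_bool (f k) * 2 ^ k)" for f m
    by (induction m) (simp_all add: str_nat_snoc)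
  from this[of "\<lambda>k. odd (j div 2 ^ (n - Suc k))" n]
  have "Suc (str_nat (msb_string n j)) = 2 ^ n + (\<Sum>k<n. (j div 2 ^ (n - Suc k) mod 2) * 2 ^ k)"
    by (simp add: msb_string_def mod_2_eq_odd)
  moreover have "(2::nat) ^ n \<ge> 1" by simp
  ultimately show ?thesis unfolding msb_code_def by linarith
qed

lemma str_of_msb_code [simp]: "str_of (msb_code n j) = msb_string n j"
  by (metis str_nat_msb_string str_of_str_nat)

lemma recursive_msb_code [recursive_intros]:
  assumes "recursive f" "recursive g"
  shows "recursive (\<lambda>x. msb_code (f x) (g x))"
  unfolding msb_code_def by (intro recursive_intros assms recursive_comp[OF assms(1)] recursive_comp[OF assms(2)])

lemma msb_string_Suc: "msb_string (Suc n) j = msb_string n (j div 2) @ [odd j]"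
  by (auto simp: msb_string_def Suc_diff_Suc simp flip: div_mult2_eq power_Suc)

lemma take_msb_string: "n \<le> m \<Longrightarrow> take n (msb_string m k) = msb_string n (k div 2 ^ (m - n))"
  by (auto simp: msb_string_def take_map take_upt simp flip: div_mult2_eq power_add)

lemma msb_string_inj: "msb_string n j = msb_string n k \<Longrightarrow> j < 2 ^ n \<Longrightarrow> k < 2 ^ n \<Longrightarrow> j = k"
proof (induction n arbitrary: j k)
  case (Suc n)
  from Suc.prems(1) have "msb_string n (j div 2) = msb_string n (k div 2)" and odd: "odd j = odd k"
    by (simp_all add: msb_string_Suc)
  from this(1) have "j div 2 = k div 2" by (rule Suc.IH) (use Suc.prems(2,3) in auto)
  then show ?case using odd by presburger
qed simp

text \<open>\<open>msb_string n j\<close> names the dyadic interval from \<open>j / 2 ^ n\<close> to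
  \<open>(j + 1) / 2 ^ n\<close>; a prefix names an interval that contains the other.\<close>

lemma prefix_msb_string:
  assumes "prefix (msb_string n j) (msb_string m k)" "j < 2 ^ n" "k < 2 ^ m"
  shows "n \<le> m" "j = k div 2 ^ (m - n)"
proof -
  show nm: "n \<le> m" using prefix_length_le[OF assms(1)] by simp
  have "msb_string n j = take n (msb_string m k)" using assms(1) by (metis length_msb_string append_eq_conv_conj prefix_def)
  then have "msb_string n j = msb_string n (k div 2 ^ (m - n))" using take_msb_string[OF nm] by simp
  moreover have "k div 2 ^ (m - n) < 2 ^ n"
    using assms(3) nm by (simp add: less_mult_imp_div_less flip: power_add)
  ultimately show "j = k div 2 ^ (m - n)" using assms(2) msb_string_inj by blast
qed

lemma real_bits_eq_msb_string:
  assumes "0 \<le> \<alpha>"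
  shows "real_bits \<alpha> n = msb_string n (nat \<lfloor>2 ^ n * \<alpha>\<rfloor>)"
proof -
  have "odd (nat \<lfloor>2 ^ (k + 1) * frac \<alpha>\<rfloor>) = odd (nat \<lfloor>2 ^ n * \<alpha>\<rfloor> div 2 ^ (n - Suc k))" if k: "k < n" for k
  proof -
    have "(2::real) ^ n = 2 ^ (k + 1) * 2 ^ (n - Suc k)" using k by (simp flip: power_Suc power_add)
    then have "2 ^ (k + 1) * \<alpha> = (2 ^ n * \<alpha>) / real_of_int (2 ^ (n - Suc k))" by simp
    also have "\<lfloor>\<dots>\<rfloor> = \<lfloor>2 ^ n * \<alpha>\<rfloor> div 2 ^ (n - Suc k)"
      by (rule floor_divide_real_eq_div) simp
    finally have fl: "\<lfloor>2 ^ (k + 1) * \<alpha>\<rfloor> = \<lfloor>2 ^ n * \<alpha>\<rfloor> div 2 ^ (n - Suc k)" .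
    \<comment> \<open>Removing the integer part changes the floor by a multiple of
      \<open>2 ^ (k + 1)\<close> and so preserves its parity.\<close>
    have "2 ^ (k + 1) * frac \<alpha> = 2 ^ (k + 1) * \<alpha> - real_of_int (2 ^ (k + 1) * \<lfloor>\<alpha>\<rfloor>)"
      by (simp add: frac_def algebra_simps)
    then have "\<lfloor>2 ^ (k + 1) * frac \<alpha>\<rfloor> = \<lfloor>2 ^ (k + 1) * \<alpha>\<rfloor> - 2 ^ (k + 1) * \<lfloor>\<alpha>\<rfloor>"
      by (simp only: floor_diff_of_int)
    then have "odd \<lfloor>2 ^ (k + 1) * frac \<alpha>\<rfloor> = odd (\<lfloor>2 ^ n * \<alpha>\<rfloor> div 2 ^ (n - Suc k))" using fl by simp
    moreover have "0 \<le> \<lfloor>2 ^ (k + 1) * frac \<alpha>\<rfloor>" by simp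
    moreover have "\<lfloor>2 ^ n * \<alpha>\<rfloor> div 2 ^ (n - Suc k) = int (nat \<lfloor>2 ^ n * \<alpha>\<rfloor> div 2 ^ (n - Suc k))"
      using assms by (simp add: zdiv_int)
    ultimately show ?thesis by (simp add: even_nat_iff del: of_nat_div)
  qed
  then show ?thesis by (auto simp: real_bits_def msb_string_def)
qed

section \<open>Prefix-free machines\<close>

text \<open>The extensions of the words in \<open>F\<close> to a common length \<open>N\<close> form
  disjoint sets, that of \<open>p\<close> having \<open>2 ^ (N - length p)\<close> elements, and
  there are \<open>2 ^ N\<close> words in all.\<close>

lemma kraft_inequality:
  fixes F :: "bool list set"
  assumes "finite F" and pf: "\<And>p q. p \<in> F \<Longrightarrow> q \<in> F \<Longrightarrow> prefix p q \<Longrightarrow> p = q"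
  shows "(\<Sum>p\<in>F. (1 / 2) ^ length p) \<le> (1::real)"
proof -
  obtain N where N: "\<And>p. p \<in> F \<Longrightarrow> length p \<le> N"
    using finite_nat_set_iff_bounded_le[of "length ` F"] assms(1) by auto
  define E where "E p = {q::bool list. length q = N \<and> prefix p q}" for p
  have lists: "finite {q::bool list. length q = n}" "card {q::bool list. length q = n} = 2 ^ n" for n
    using finite_lists_length_eq[of "UNIV::bool set" n] card_lists_length_eq[of "UNIV::bool set" n] by simp_all
  have fE: "finite (E p)" for p unfolding E_def by (rule finite_subset[OF _ lists(1)[of N]]) auto
  have cE: "card (E p) = 2 ^ (N - length p)" if "p \<in> F" for p
  proof -
    have "E p = (\<lambda>q. p @ q) ` {q. length q = N - length p}"
      unfolding E_def prefix_def using N[OF that] by (auto simp: image_iff)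
    then show ?thesis by (simp add: card_image inj_on_def lists)
  qed
  have "card (\<Union>p\<in>F. E p) = (\<Sum>p\<in>F. card (E p))"
  proof (rule card_UN_disjoint)
    show "\<forall>p\<in>F. \<forall>q\<in>F. p \<noteq> q \<longrightarrow> E p \<inter> E q = {}"
      unfolding E_def using pf prefix_same_cases by fastforce
  qed (use assms(1) fE in auto)
  also have "\<dots> = (\<Sum>p\<in>F. 2 ^ (N - length p))" using cE by simp
  finally have "(\<Sum>p\<in>F. 2 ^ (N - length p)) = card (\<Union>p\<in>F. E p)" by simp
  also have "\<dots> \<le> card {q::bool list. length q = N}" by (rule card_mono) (auto simp: E_def lists)
  finally have "(\<Sum>p\<in>F. 2 ^ (N - length p)) \<le> (2::nat) ^ N" by (simp add: lists)
  then have "real (\<Sum>p\<in>F. 2 ^ (N - length p)) \<le> real (2 ^ N)" by (rule of_nat_mono)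
  then have "(\<Sum>p\<in>F. 2 ^ (N - length p)) / 2 ^ N \<le> (1::real)" by simp
  moreover have "(\<Sum>p\<in>F. 2 ^ (N - length p)) / 2 ^ N = (\<Sum>p\<in>F. (1 / 2 :: real) ^ length p)"
    unfolding sum_divide_distrib using N by (intro sum.cong) (auto simp: power_diff power_divide)
  ultimately show ?thesis by simp
qed

lemma Hc_le: "C p = Some s \<Longrightarrow> Hc C s \<le> enat (length p)"
  unfolding Hc_def by (rule INF_lower) simp

lemma Theta_set_iff: "s \<in> Theta_set V \<longleftrightarrow> (\<exists>p. V p = Some s \<and> length p < length s)"
  unfolding Theta_set_def Hc_def by (auto simp: INF_less_iff)

lemma prefix_free_machineD:
  "prefix_free_machine C \<Longrightarrow> p \<in> dom C \<Longrightarrow> q \<in> dom C \<Longrightarrow> prefix p q \<Longrightarrow> p = q"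
  unfolding prefix_free_machine_def by blast

text \<open>Distinct strings have distinct programs. Each chosen program is strictly shorter than
  its string and hence weighs at least twice as much, so Kraft's inequality for the programs gives
  1/2.\<close>

lemma Theta_set_kraft:
  assumes V: "prefix_free_machine V" and F: "finite F" "F \<subseteq> Theta_set V"
  shows "(\<Sum>s\<in>F. (1 / 2) ^ length s) \<le> (1 / 2 :: real)"
proof -
  obtain p where p: "\<And>s. s \<in> F \<Longrightarrow> V (p s) = Some s" "\<And>s. s \<in> F \<Longrightarrow> length (p s) < length s"
    using F(2) unfolding Theta_set_iff subset_iff by metis
  have inj: "inj_on p F" using p(1) by (metis inj_onI option.inject)
  have "(\<Sum>s\<in>F. (1 / 2) ^ length s) \<le> (\<Sum>s\<in>F. (1 / 2 :: real) ^ Suc (length (p s)))"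
    by (intro sum_mono power_decreasing) (use p(2) in \<open>auto simp: Suc_le_eq\<close>)
  also have "\<dots> = (1 / 2) * (\<Sum>q\<in>p ` F. (1 / 2) ^ length q)"
    by (simp add: sum.reindex[OF inj] sum_distrib_left)
  also have "(\<Sum>q\<in>p ` F. (1 / 2 :: real) ^ length q) \<le> 1"
    by (rule kraft_inequality) (use F p(1) prefix_free_machineD[OF V] in \<open>auto simp: domI\<close>)
  finally show ?thesis by simp
qed

text \<open>All strings of length \<open>n\<close> together weigh 1, more than the 1/2 available to
  compressible ones.\<close>

lemma incompressible_string:
  assumes "prefix_free_machine V"
  obtains s where "length s = n" "s \<notin> Theta_set V"
proof -
  have "\<not> {s. length s = n} \<subseteq> Theta_set V"
  proof
    assume "{s. length s = n} \<subseteq> Theta_set V"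
    moreover have "finite {q::bool list. length q = n}" "card {q::bool list. length q = n} = 2 ^ n"
      using finite_lists_length_eq[of "UNIV::bool set" n] card_lists_length_eq[of "UNIV::bool set" n] by simp_all
    moreover from this(2) have "(\<Sum>s\<in>{s::bool list. length s = n}. (1 / 2 :: real) ^ length s) = 1"
      by (simp add: power_divide)
    ultimately show False using Theta_set_kraft[OF assms, of "{s. length s = n}"] by simp
  qed
  then show thesis using that by blast
qed

lemma semidecidable_machine:
  assumes "prefix_free_machine C"
  shows "semidecidable (\<lambda>z. C (str_of (pfst z)) = Some (str_of (psnd z)))"
proof -
  from assms obtain r where "\<And>p y. C p = Some y \<longleftrightarrow> eval r [str_nat p] (str_nat y)"
    unfolding prefix_free_machine_def by blast
  then show ?thesis using semidecidable_eval[of r] by simp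
qed

text \<open>Uniformization yields a selector for \<open>R\<close>; as \<open>R\<close> is
  single-valued, the graph of the selector is all of \<open>R\<close>.\<close>

lemma machine_of_relation:
  assumes R: "semidecidable (\<lambda>z. R (pfst z) (psnd z))"
    and single: "\<And>x y y'. R x y \<Longrightarrow> R x y' \<Longrightarrow> y = y'"
    and pf: "\<And>p q y y'. R (str_nat p) y \<Longrightarrow> R (str_nat q) y' \<Longrightarrow> prefix p q \<Longrightarrow> p = q"
  obtains C where "prefix_free_machine C" "\<And>p y. C p = Some y \<longleftrightarrow> R (str_nat p) (str_nat y)"
proof -
  obtain r where "\<And>x y. eval r [x] y \<Longrightarrow> R x y" "\<And>x y. R x y \<Longrightarrow> \<exists>y'. eval r [x] y'"
    using semidecidable_uniformization[OF R] by metis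
  then have r: "eval r [x] y \<longleftrightarrow> R x y" for x y using single by metis
  define C where "C p = (if \<exists>y. R (str_nat p) y then Some (str_of (THE y. R (str_nat p) y)) else None)" for p
  have C: "C p = Some y \<longleftrightarrow> R (str_nat p) (str_nat y)" for p y
  proof (cases "\<exists>y. R (str_nat p) y")
    case True
    then obtain z where z: "R (str_nat p) z" by blast
    then have "(THE y. R (str_nat p) y) = z" using single by blast
    then have "C p = Some (str_of z)" unfolding C_def using z by auto
    then show ?thesis using z single by (metis option.inject str_nat_str_of str_of_str_nat)
  qed (auto simp: C_def)
  have "prefix_free_machine C" unfolding prefix_free_machine_def
  proof (intro conjI allI impI exI[of _ r])
    show "C p = Some y \<longleftrightarrow> eval r [str_nat p] (str_nat y)" for p y unfolding C r ..
    show "p = q" if "p \<in> dom C" "q \<in> dom C" "prefix p q" for p q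
    proof -
      from that(1,2) obtain y y' where "C p = Some y" "C q = Some y'" by blast
      then show ?thesis using pf[OF _ _ that(3)] unfolding C by blast
    qed
  qed
  with C that show thesis by blast
qed

lemma optimal_machineD:
  assumes "optimal_machine U" "prefix_free_machine C"
  obtains d where "\<And>p y. C p = Some y \<Longrightarrow> Hc U y \<le> enat (length p + d)"
proof -
  from assms obtain d where d: "\<And>p. p \<in> dom C \<Longrightarrow> \<exists>q\<in>dom U. U q = C p \<and> length q \<le> length p + d"
    unfolding optimal_machine_def by metis
  show thesis
  proof (rule that[of d])
    fix p y assume Cp: "C p = Some y"
    then obtain q where "U q = Some y" "length q \<le> length p + d" using d[of p] by auto
    then show "Hc U y \<le> enat (length p + d)" using Hc_le[of U q y] by (meson enat_ord_simps(1) order_trans)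
  qed
qed

text \<open>Request \<open>k\<close> receives the aligned dyadic interval of length \<open>2 ^ - (l k + c + 1)\<close> that starts at
  the first grid point after \<open>S k\<close>; it lies inside \<open>(S k, S (Suc k)]\<close>, so the intervals are disjoint.\<close>

lemma kraft_chaitin:
  assumes U: "optimal_machine U" and P: "decidable P" and l: "recursive l" and y: "recursive y"
    and bound: "\<And>K. (\<Sum>k<K. if P k then (1 / 2) ^ l k else 0) \<le> (2::real) ^ c"
  obtains d where "\<And>k. P k \<Longrightarrow> Hc U (str_of (y k)) \<le> enat (l k + d)"
proof -
  define S where "S k = (\<Sum>i<k. if P i then (1 / 2 :: real) ^ (l i + c) else 0)" for k
  \<comment> \<open>The exponent \<open>c\<close> scales the total weight to at most 1. The extra 1
    makes the room for request \<open>k\<close> two grid cells long, and such a stretch contains a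
    full aligned cell wherever it starts.\<close>
  define L where "L k = l k + c + 1" for k
  \<comment> \<open>\<open>M k\<close> bounds all \<open>L i\<close> with \<open>i \<le> k\<close>,
    so \<open>2 ^ M k\<close> is a common denominator of \<open>S k\<close> and the grid, and
    \<open>j k\<close> comes from an integer division.\<close>
  define M where "M k = (\<Sum>i<Suc k. L i)" for k
  define N where "N k = (\<Sum>i<k. if P i then 2 ^ (M k - (l i + c)) else 0::nat)" for k
  define j where "j k = N k div 2 ^ (M k - L k) + 1" for k
  define R where "R x z \<longleftrightarrow> (\<exists>k. P k \<and> x = msb_code (L k) (j k) \<and> z = y k)" for x z
  have S1: "S k \<le> 1" for k
  proof -
    have "S k = (\<Sum>i<k. if P i then (1 / 2) ^ l i else 0) / 2 ^ c"
      unfolding S_def sum_divide_distrib by (intro sum.cong) (auto simp: power_add power_divide)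
    then show ?thesis using bound[of k] by simp
  qed
  have Smono: "S k \<le> S k'" if "k \<le> k'" for k k'
    unfolding S_def using that by (intro sum_mono2) auto
  have SSuc: "S (Suc k) = S k + 2 / 2 ^ L k" if "P k" for k
    using that by (simp add: S_def L_def power_divide)
  have LM: "L i \<le> M k" if "i \<le> k" for i k
    unfolding M_def using that by (intro member_le_sum) auto
  have SN: "S k = real (N k) / 2 ^ M k" for k
    unfolding S_def N_def of_nat_sum sum_divide_distrib
  proof (intro sum.cong refl)
    fix i assume "i \<in> {..<k}"
    then have "l i + c \<le> M k" using LM[of i k] by (simp add: L_def)
    then have "(2::real) ^ M k = 2 ^ (l i + c) * 2 ^ (M k - (l i + c))" by (simp flip: power_add)
    then show "(if P i then (1 / 2) ^ (l i + c) else 0) =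
        real (if P i then 2 ^ (M k - (l i + c)) else 0) / 2 ^ M k"
      by (simp add: power_divide)
  qed
  have jlow: "S k < real (j k) / 2 ^ L k" and jupp: "real (j k) + 1 \<le> (S k + 2 / 2 ^ L k) * 2 ^ L k" for k
  proof -
    have "(2::real) ^ M k = 2 ^ L k * 2 ^ (M k - L k)" using LM[of k k] by (simp flip: power_add)
    then have *: "S k * 2 ^ L k = real (N k) / real (2 ^ (M k - L k))"
      unfolding SN by simp
    define D where "D = (2::nat) ^ (M k - L k)"
    have "D > 0" by (simp add: D_def)
    have "N k div D * D \<le> N k" "N k < (N k div D + 1) * D"
      using dividend_less_div_times[OF \<open>D > 0\<close>, of "N k"] by simp_all
    then have "real (N k div D * D) \<le> real (N k)" "real (N k) < real ((N k div D + 1) * D)"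
      by (simp_all only: of_nat_le_iff of_nat_less_iff)
    then have "real (N k div D) \<le> S k * 2 ^ L k" "S k * 2 ^ L k < real (N k div D) + 1"
      using \<open>D > 0\<close> unfolding * D_def[symmetric] by (simp_all add: le_divide_eq divide_less_eq distrib_right add.commute)
    then show "real (j k) + 1 \<le> (S k + 2 / 2 ^ L k) * 2 ^ L k" "S k < real (j k) / 2 ^ L k"
      by (simp_all add: j_def D_def[symmetric] field_simps)
  qed
  have jup: "(real (j k) + 1) / 2 ^ L k \<le> S (Suc k)" if "P k" for k
    unfolding SSuc[OF that] using jupp[of k] by (subst pos_divide_le_eq) simp_all
  have jlt: "j k < 2 ^ L k" if "P k" for k
  proof -
    have "real (j k) + 1 \<le> 2 ^ L k" using jup[OF that] S1[of "Suc k"]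
      by (smt (verit) divide_le_eq_1 zero_less_power)
    then have "real (j k) < real (2 ^ L k)" unfolding of_nat_power of_nat_numeral by linarith
    then show ?thesis by (simp only: of_nat_less_iff)
  qed
  \<comment> \<open>A prefix nests the two intervals, whereas those of distinct requests are
    disjoint; either order of \<open>k\<close> and \<open>k'\<close> is refuted by comparing end
    points.\<close>
  have pf: "k = k'" if k: "P k" and k': "P k'" and pre: "prefix (msb_string (L k) (j k)) (msb_string (L k') (j k'))" for k k'
  proof -
    note pm = prefix_msb_string[OF pre jlt[OF k] jlt[OF k']]
    let ?e = "L k' - L k"
    have "j k * 2 ^ ?e \<le> j k'" "j k' < (j k + 1) * 2 ^ ?e"
      unfolding pm(2) by (simp_all add: dividend_less_div_times)
    then have "real (j k * 2 ^ ?e) \<le> real (j k')" "real (j k') < real ((j k + 1) * 2 ^ ?e)"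
      by (simp_all only: of_nat_le_iff of_nat_less_iff)
    moreover have "(2::real) ^ L k' = 2 ^ L k * 2 ^ ?e" using pm(1) by (simp flip: power_add)
    ultimately have nest: "real (j k) / 2 ^ L k \<le> real (j k') / 2 ^ L k'"
        "real (j k') / 2 ^ L k' < (real (j k) + 1) / 2 ^ L k"
      by (simp_all add: field_simps)
    have "\<not> k < k'"
      using nest(2) jup[OF k] Smono[of "Suc k" k'] jlow[of k'] by (intro notI) simp
    moreover have "\<not> k' < k"
    proof
      assume "k' < k"
      then have "(real (j k') + 1) / 2 ^ L k' < real (j k) / 2 ^ L k"
        using jup[OF k'] Smono[of "Suc k'" k] jlow[of k] by simp
      moreover have "real (j k') / 2 ^ L k' < (real (j k') + 1) / 2 ^ L k'" by (simp add: divide_strict_right_mono)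
      ultimately show False using nest(1) by simp
    qed
    ultimately show ?thesis by simp
  qed
  have RE: thesis' if "R x z" "\<And>k. P k \<Longrightarrow> x = str_nat (msb_string (L k) (j k)) \<Longrightarrow> z = y k \<Longrightarrow> thesis'" for x z thesis'
    using that unfolding R_def str_nat_msb_string by blast
  have recL: "recursive L" unfolding L_def by (intro recursive_intros l)
  have recM: "recursive M" unfolding M_def by (intro recursive_intros recursive_comp[OF recL])
  have recN: "recursive N" unfolding N_def
    by (intro recursive_intros recursive_comp[OF recM] recursive_comp[OF l] decidable_comp[OF P])
  have recj: "recursive j" unfolding j_def by (intro recursive_intros recN recM recL)
  obtain C where C: "prefix_free_machine C" "\<And>p z. C p = Some z \<longleftrightarrow> R (str_nat p) (str_nat z)"
  proof (rule machine_of_relation[of R])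
    show "semidecidable (\<lambda>z. R (pfst z) (psnd z))" unfolding R_def
      by (intro semidecidable_ex semidecidable_decidable recursive_intros decidable_comp[OF P]
          recursive_comp[OF recL] recursive_comp[OF recj] recursive_comp[OF y])
    show "z = z'" if "R x z" "R x z'" for x z z'
      using that pf by (elim RE) (metis inj_str_nat prefix_order.refl)
    show "p = q" if "R (str_nat p) z" "R (str_nat q) z'" "prefix p q" for p q z z'
      using that pf by (elim RE) (metis inj_str_nat)
  qed blast
  obtain d where d: "\<And>p z. C p = Some z \<Longrightarrow> Hc U z \<le> enat (length p + d)"
    using optimal_machineD[OF U C(1)] by metis
  show thesis
  proof (rule that[of "c + 1 + d"])
    fix k assume "P k"
    then have "C (msb_string (L k) (j k)) = Some (str_of (y k))"
      unfolding C(2) R_def str_nat_msb_string by auto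
    from d[OF this] show "Hc U (str_of (y k)) \<le> enat (l k + (c + 1 + d))"
      by (simp add: L_def ac_simps)
  qed
qed

section \<open>Computable reals\<close>

lemma computable_real_cuts:
  assumes "computable_real T" "T > 0"
  shows "semidecidable (\<lambda>z. real (pfst z) < real (psnd z) * T)"
    and "semidecidable (\<lambda>z. real (psnd z) * T < real (pfst z))"
proof -
  from assms(1) obtain f where "total_recursive_rat f"
    and f: "\<And>n. n \<ge> 1 \<Longrightarrow> \<bar>T - real_of_rat (f n)\<bar> < 1 / real n"
    unfolding computable_real_def by blast
  then obtain ra rb where ra: "\<And>n. eval ra [n] (int_encode (fst (quotient_of (f n))))"
    and rb: "\<And>n. eval rb [n] (nat (snd (quotient_of (f n))))"
    unfolding total_recursive_rat_def by blast
  \<comment> \<open>Negative numerators become 0, which keeps the arithmetic in \<open>nat\<close>;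
    as \<open>T > 0\<close>, the error stays below \<open>1 / n\<close>.\<close>
  define h where "h n = nat (fst (quotient_of (f n)))" for n
  define b where "b n = nat (snd (quotient_of (f n)))" for n
  have recb: "recursive b" unfolding b_def recursive_def using rb by blast
  have recc: "recursive (\<lambda>n. int_encode (fst (quotient_of (f n))))" unfolding recursive_def using ra by blast
  have "nat i = (if even (int_encode i) then int_encode i div 2 else 0)" for i
    by (simp add: int_encode_def sum_encode_def)
  then have "h = (\<lambda>n. if even (int_encode (fst (quotient_of (f n))))
      then int_encode (fst (quotient_of (f n))) div 2 else 0)" unfolding h_def by blast
  then have rech: "recursive h" by (simp only:) (intro recursive_intros recc)
  have b: "b n > 0" for n unfolding b_def using quotient_of_denom_pos'[of "f n"] by simp
  have approx: "\<bar>T - real (h n) / real (b n)\<bar> < 1 / real n" if n: "n \<ge> 1" for n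
  proof -
    obtain p q where pq: "quotient_of (f n) = (p, q)" by fastforce
    have q: "q > 0" using quotient_of_denom_pos[OF pq] .
    have fn: "real_of_rat (f n) = real_of_int p / real_of_int q"
      using quotient_of_div[OF pq] by (simp add: of_rat_divide)
    have bn: "real (b n) = real_of_int q" using q pq by (simp add: b_def)
    show ?thesis
    proof (cases "p \<ge> 0")
      case True
      then have "real (h n) = real_of_int p" using pq by (simp add: h_def)
      then show ?thesis using f[OF n] fn bn by simp
    next
      case False
      then have "real_of_rat (f n) < 0" unfolding fn using q by (simp add: divide_neg_pos)
      then have "\<bar>T\<bar> < 1 / real n" using f[OF n] assms(2) by linarith
      moreover have "h n = 0" using False pq by (simp add: h_def)
      ultimately show ?thesis by simp
    qed
  qed
  have large: "\<exists>n\<ge>1. 2 * real q / real n < e" if "e > 0" for q :: nat and e :: real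
  proof -
    obtain n where "real n > 2 * real q / e" using reals_Archimedean2 by blast
    then show ?thesis using that by (intro exI[of _ "Suc n"]) (simp add: field_simps)
  qed
  \<comment> \<open>One \<open>1 / n\<close> is the error of the approximation, another the margin
    demanded by the test; hence an \<open>n\<close> with \<open>2 * q / n\<close> below the gap is
    sought. Multiplication by \<open>n * b n\<close> puts the test into natural numbers.\<close>
  have low: "real p < real q * T \<longleftrightarrow> (\<exists>n. n \<ge> 1 \<and> p * n * b n + q * b n < q * n * h n)" for p q
  proof -
    have eq: "p * n * b n + q * b n < q * n * h n \<longleftrightarrow> real p < real q * (real (h n) / real (b n) - 1 / real n)"
      if "n \<ge> 1" for n
    proof -
      have "p * n * b n + q * b n < q * n * h n \<longleftrightarrow>
          real (p * n * b n + q * b n) < real (q * n * h n)" by (simp only: of_nat_less_iff)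
      then show ?thesis using that b[of n] by (simp add: field_simps)
    qed
    show ?thesis
    proof
      assume "real p < real q * T"
      then obtain n where n: "n \<ge> 1" "2 * real q / real n < real q * T - real p"
        using large[of "real q * T - real p" q] by auto
      have "real p < real q * (T - 2 / real n)" using n(2) by (simp add: right_diff_distrib)
      also have "\<dots> \<le> real q * (real (h n) / real (b n) - 1 / real n)"
        using approx[OF n(1)] by (intro mult_left_mono) auto
      finally show "\<exists>n. n \<ge> 1 \<and> p * n * b n + q * b n < q * n * h n"
        using n(1) eq[OF n(1)] by blast
    next
      assume "\<exists>n. n \<ge> 1 \<and> p * n * b n + q * b n < q * n * h n"
      then obtain n where n: "n \<ge> 1" "real p < real q * (real (h n) / real (b n) - 1 / real n)"
        using eq by blast
      moreover have "real q * (real (h n) / real (b n) - 1 / real n) \<le> real q * T"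
        using approx[OF n(1)] by (intro mult_left_mono) auto
      ultimately show "real p < real q * T" by linarith
    qed
  qed
  have upp: "real q * T < real p \<longleftrightarrow> (\<exists>n. n \<ge> 1 \<and> q * n * h n + q * b n < p * n * b n)" for p q
  proof -
    have eq: "q * n * h n + q * b n < p * n * b n \<longleftrightarrow> real q * (real (h n) / real (b n) + 1 / real n) < real p"
      if "n \<ge> 1" for n
    proof -
      have "q * n * h n + q * b n < p * n * b n \<longleftrightarrow>
          real (q * n * h n + q * b n) < real (p * n * b n)" by (simp only: of_nat_less_iff)
      then show ?thesis using that b[of n] by (simp add: field_simps)
    qed
    show ?thesis
    proof
      assume "real q * T < real p"
      then obtain n where n: "n \<ge> 1" "2 * real q / real n < real p - real q * T"
        using large[of "real p - real q * T" q] by auto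
      have "real q * (real (h n) / real (b n) + 1 / real n) \<le> real q * (T + 2 / real n)"
        using approx[OF n(1)] by (intro mult_left_mono) auto
      also have "\<dots> < real p" using n(2) by (simp add: distrib_left mult.commute)
      finally show "\<exists>n. n \<ge> 1 \<and> q * n * h n + q * b n < p * n * b n"
        using n(1) eq[OF n(1)] by blast
    next
      assume "\<exists>n. n \<ge> 1 \<and> q * n * h n + q * b n < p * n * b n"
      then obtain n where n: "n \<ge> 1" "real q * (real (h n) / real (b n) + 1 / real n) < real p"
        using eq by blast
      moreover have "real q * T \<le> real q * (real (h n) / real (b n) + 1 / real n)"
        using approx[OF n(1)] by (intro mult_left_mono) auto
      ultimately show "real q * T < real p" by linarith
    qed
  qed
  show "semidecidable (\<lambda>z. real (pfst z) < real (psnd z) * T)" unfolding low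
    by (intro semidecidable_ex semidecidable_decidable recursive_intros recursive_comp[OF rech] recursive_comp[OF recb])
  show "semidecidable (\<lambda>z. real (psnd z) * T < real (pfst z))" unfolding upp
    by (intro semidecidable_ex semidecidable_decidable recursive_intros recursive_comp[OF rech] recursive_comp[OF recb])
qed

text \<open>With \<open>T\<close> replaced by the rational \<open>p / q\<close>, raising both sides
  to the power \<open>p\<close> and multiplying by \<open>2 ^ (L * q)\<close> leaves a comparison of
  natural numbers.\<close>

lemma powr_rational_compare:
  fixes a p q L N :: nat
  assumes "p > 0"
  shows "real a < 2 powr (real N - real L * (real q / real p)) \<longleftrightarrow> a ^ p * 2 ^ (L * q) < 2 ^ (N * p)"
    and "2 powr (real N - real L * (real q / real p)) < real a \<longleftrightarrow> 2 ^ (N * p) < a ^ p * 2 ^ (L * q)"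
proof -
  define v where "v = 2 powr (real N - real L * (real q / real p))"
  have v: "v > 0" by (simp add: v_def)
  have "v ^ p = 2 powr ((real N - real L * (real q / real p)) * real p)"
    unfolding v_def by (simp add: powr_power mult.commute)
  also have "(real N - real L * (real q / real p)) * real p = real (N * p) - real (L * q)"
    using assms by (simp add: field_simps)
  also have "2 powr \<dots> = 2 ^ (N * p) / 2 ^ (L * q)"
    by (simp only: powr_diff powr_realpow zero_less_numeral)
  finally have vp: "v ^ p * 2 ^ (L * q) = 2 ^ (N * p)" by simp
  have "real a < v \<longleftrightarrow> real a ^ p < v ^ p" using assms v
    by (meson less_imp_le of_nat_0_le_iff power_less_imp_less_base power_strict_mono)
  also have "\<dots> \<longleftrightarrow> real a ^ p * 2 ^ (L * q) < v ^ p * 2 ^ (L * q)" by simp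
  also have "\<dots> \<longleftrightarrow> real (a ^ p * 2 ^ (L * q)) < real (2 ^ (N * p))" unfolding vp by simp
  finally show "real a < 2 powr (real N - real L * (real q / real p)) \<longleftrightarrow> a ^ p * 2 ^ (L * q) < 2 ^ (N * p)"
    unfolding v_def[symmetric] by (simp only: of_nat_less_iff)
  have "v < real a \<longleftrightarrow> v ^ p < real a ^ p" using assms v
    by (meson less_imp_le of_nat_0_le_iff power_less_imp_less_base power_strict_mono)
  also have "\<dots> \<longleftrightarrow> v ^ p * 2 ^ (L * q) < real a ^ p * 2 ^ (L * q)" by simp
  also have "\<dots> \<longleftrightarrow> real (2 ^ (N * p)) < real (a ^ p * 2 ^ (L * q))" unfolding vp by simp
  finally show "2 powr (real N - real L * (real q / real p)) < real a \<longleftrightarrow> 2 ^ (N * p) < a ^ p * 2 ^ (L * q)"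
    unfolding v_def[symmetric] by (simp only: of_nat_less_iff)
qed

lemma rational_between:
  fixes x y :: real
  assumes "0 \<le> x" "x < y"
  obtains p q :: nat where "p > 0" "q > 0" "x < real p / real q" "real p / real q < y"
proof -
  obtain r where r: "r \<in> \<rat>" "x < r" "r < y" using Rats_dense_in_real[OF assms(2)] by blast
  then have "r > 0" using assms(1) by simp
  obtain p q :: nat where "q \<noteq> 0" "\<bar>r\<bar> = real p / real q" using Rats_abs_nat_div_natE[OF r(1)] by metis
  then have "r = real p / real q" "q > 0" using \<open>r > 0\<close> by auto
  moreover from this have "p > 0" using \<open>r > 0\<close> by (cases p) auto
  ultimately show thesis using that r by blast
qed

text \<open>The power is continuous and nondecreasing in \<open>T\<close>. A strict lower bound
  therefore persists at some rational \<open>p / q\<close> slightly below \<open>T\<close>, and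
  conversely any such rational certifies it by monotonicity. Only the cut of \<open>T\<close>
  remains to be semidecided.\<close>

lemma powr_cut_lower:
  fixes a L N :: nat
  assumes T: "T > 0"
  shows "real a < 2 powr (real N - real L / T) \<longleftrightarrow>
    (\<exists>p q. (p > 0 \<and> q > 0 \<and> a ^ p * 2 ^ (L * q) < 2 ^ (N * p)) \<and> real p < real q * T)"
proof
  assume a: "real a < 2 powr (real N - real L / T)"
  have "((\<lambda>x. 2 powr (real N - real L / x)) \<longlongrightarrow> 2 powr (real N - real L / T)) (at_left T)"
    using T by (intro tendsto_intros) auto
  then have "\<forall>\<^sub>F x in at_left T. real a < 2 powr (real N - real L / x)"
    using a by (rule order_tendstoD(1))
  then obtain e where e: "e < T" "\<And>x. e < x \<Longrightarrow> x < T \<Longrightarrow> real a < 2 powr (real N - real L / x)"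
    unfolding eventually_at_left_field by blast
  obtain p q :: nat where pq: "p > 0" "q > 0" "max 0 e < real p / real q" "real p / real q < T"
    using rational_between[of "max 0 e" T] e(1) T by auto
  have "real a < 2 powr (real N - real L * (real q / real p))"
    using e(2)[of "real p / real q"] pq by simp
  then have "a ^ p * 2 ^ (L * q) < 2 ^ (N * p)" using powr_rational_compare(1)[OF pq(1)] by blast
  moreover have "real p < real q * T" using pq by (simp add: field_simps)
  ultimately show "\<exists>p q. (p > 0 \<and> q > 0 \<and> a ^ p * 2 ^ (L * q) < 2 ^ (N * p)) \<and> real p < real q * T"
    using pq by blast
next
  assume "\<exists>p q. (p > 0 \<and> q > 0 \<and> a ^ p * 2 ^ (L * q) < 2 ^ (N * p)) \<and> real p < real q * T"
  then obtain p q where pq: "p > 0" "q > 0" "a ^ p * 2 ^ (L * q) < 2 ^ (N * p)" "real p < real q * T"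
    by blast
  have "real a < 2 powr (real N - real L * (real q / real p))"
    using powr_rational_compare(1)[OF pq(1)] pq(3) by blast
  also have "1 / T \<le> real q / real p" using pq T by (simp add: field_simps)
  then have "real L * (1 / T) \<le> real L * (real q / real p)" by (intro mult_left_mono) auto
  then have "2 powr (real N - real L * (real q / real p)) \<le> 2 powr (real N - real L / T)" by simp
  finally show "real a < 2 powr (real N - real L / T)" .
qed

lemma powr_cut_upper:
  fixes a L N :: nat
  assumes T: "T > 0"
  shows "2 powr (real N - real L / T) < real a \<longleftrightarrow>
    (\<exists>p q. (p > 0 \<and> q > 0 \<and> 2 ^ (N * p) < a ^ p * 2 ^ (L * q)) \<and> real q * T < real p)"
proof
  assume a: "2 powr (real N - real L / T) < real a"
  have "((\<lambda>x. 2 powr (real N - real L / x)) \<longlongrightarrow> 2 powr (real N - real L / T)) (at_right T)"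
    using T by (intro tendsto_intros) auto
  then have "\<forall>\<^sub>F x in at_right T. 2 powr (real N - real L / x) < real a"
    using a by (rule order_tendstoD(2))
  then obtain e where e: "T < e" "\<And>x. T < x \<Longrightarrow> x < e \<Longrightarrow> 2 powr (real N - real L / x) < real a"
    unfolding eventually_at_right_field by blast
  obtain p q :: nat where pq: "p > 0" "q > 0" "T < real p / real q" "real p / real q < e"
    using rational_between[of T e] e(1) T by auto
  have "2 powr (real N - real L * (real q / real p)) < real a"
    using e(2)[of "real p / real q"] pq by simp
  then have "2 ^ (N * p) < a ^ p * 2 ^ (L * q)" using powr_rational_compare(2)[OF pq(1)] by blast
  moreover have "real q * T < real p" using pq by (simp add: field_simps)
  ultimately show "\<exists>p q. (p > 0 \<and> q > 0 \<and> 2 ^ (N * p) < a ^ p * 2 ^ (L * q)) \<and> real q * T < real p"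
    using pq by blast
next
  assume "\<exists>p q. (p > 0 \<and> q > 0 \<and> 2 ^ (N * p) < a ^ p * 2 ^ (L * q)) \<and> real q * T < real p"
  then obtain p q where pq: "p > 0" "q > 0" "2 ^ (N * p) < a ^ p * 2 ^ (L * q)" "real q * T < real p"
    by blast
  have "real q / real p \<le> 1 / T" using pq T by (simp add: field_simps)
  then have "real L * (real q / real p) \<le> real L * (1 / T)" by (intro mult_left_mono) auto
  then have "2 powr (real N - real L / T) \<le> 2 powr (real N - real L * (real q / real p))" by simp
  also have "\<dots> < real a" using powr_rational_compare(2)[OF pq(1)] pq(3) by blast
  finally show "2 powr (real N - real L / T) < real a" .
qed

text \<open>The exact floor is out of reach of strict inequalities. A window of width 2 leaves room:
  the ceiling of the power minus 1 always satisfies both inequalities, and the effective choice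
  returns this or another solution.\<close>

lemma recursive_powr_approximation:
  assumes T: "computable_real T" "T > 0"
  obtains W where "recursive (\<lambda>z. W (pfst z) (psnd z))"
    "\<And>L N. real (W L N) < 2 powr (real N - real L / T)"
    "\<And>L N. 2 powr (real N - real L / T) < real (W L N) + 2"
proof -
  define R where "R z a \<longleftrightarrow> real a < 2 powr (real (psnd z) - real (pfst z) / T) \<and>
      2 powr (real (psnd z) - real (pfst z) / T) < real (a + 2)" for z a
  have "semidecidable (\<lambda>z. R (pfst z) (psnd z))"
    unfolding R_def powr_cut_lower[OF T(2)] powr_cut_upper[OF T(2)]
    by (intro semidecidable_conj semidecidable_ex;
        (intro semidecidable_comp2[OF computable_real_cuts(1)[OF T]]
          semidecidable_comp2[OF computable_real_cuts(2)[OF T]] recursive_intros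
         | intro semidecidable_decidable recursive_intros))
  moreover have "\<exists>a. R z a" for z
  proof -
    define x where "x = 2 powr (real (psnd z) - real (pfst z) / T)"
    have "x > 0" by (simp add: x_def)
    then have c: "\<lceil>x\<rceil> \<ge> 1" by (simp add: le_ceiling_iff)
    then have "real (nat (\<lceil>x\<rceil> - 1)) = real_of_int \<lceil>x\<rceil> - 1" by simp
    then have "real (nat (\<lceil>x\<rceil> - 1)) < x" "x < real (nat (\<lceil>x\<rceil> - 1) + 2)"
      using ceiling_correct[of x] by linarith+
    then show ?thesis unfolding R_def x_def by blast
  qed
  ultimately obtain w where w: "recursive w" "\<And>z. R z (w z)"
    using semidecidable_total_choice by metis
  show thesis
  proof (rule that[of "\<lambda>L N. w (pair L N)"])
    show "recursive (\<lambda>z. w (pair (pfst z) (psnd z)))" using w(1) by simp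
    show "real (w (pair L N)) < 2 powr (real N - real L / T)"
      "2 powr (real N - real L / T) < real (w (pair L N)) + 2" for L N
      using w(2)[of "pair L N"] by (simp_all add: R_def)
  qed
qed

lemma recursive_multiple_approximation:
  assumes T: "computable_real T" "T > 0"
  obtains l where "recursive l" "\<And>n. \<bar>real (l n) - T * real n\<bar> < 1"
proof -
  \<comment> \<open>With truncated subtraction \<open>m - 1\<close> is 0 at \<open>m = 0\<close>,
    and the strict inequality would fail for \<open>n = 0\<close>; the disjunct \<open>m = 0\<close>
    covers this case.\<close>
  define R where "R n m \<longleftrightarrow> real n * T < real (m + 1) \<and> (m = 0 \<or> real (m - 1) < real n * T)" for n m
  have "semidecidable (\<lambda>z. R (pfst z) (psnd z))"
    unfolding R_def
    by (intro semidecidable_conj semidecidable_disj;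
        (intro semidecidable_comp2[OF computable_real_cuts(1)[OF T]]
          semidecidable_comp2[OF computable_real_cuts(2)[OF T]] recursive_intros
         | intro semidecidable_decidable recursive_intros))
  moreover have "\<exists>m. R n m" for n
  proof -
    have "0 \<le> \<lfloor>real n * T\<rfloor>" using T by simp
    then have "real (nat \<lfloor>real n * T\<rfloor>) = real_of_int \<lfloor>real n * T\<rfloor>" by simp
    then have "real (nat \<lfloor>real n * T\<rfloor>) \<le> real n * T" "real n * T < real (nat \<lfloor>real n * T\<rfloor> + 1)"
      by linarith+
    then show ?thesis unfolding R_def by (intro exI[of _ "nat \<lfloor>real n * T\<rfloor>"]) auto
  qed
  ultimately obtain l where l: "recursive l" "\<And>n. R n (l n)"
    using semidecidable_total_choice by metis
  show thesis
  proof (rule that[OF l(1)])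
    show "\<bar>real (l n) - T * real n\<bar> < 1" for n
    proof (cases "l n = 0")
      case True
      then show ?thesis using l(2)[of n] T unfolding R_def by (simp add: mult.commute abs_mult)
    next
      case False
      then have "real (l n - 1) = real (l n) - 1" by simp
      then show ?thesis using l(2)[of n] False unfolding R_def by (auto simp: mult.commute abs_less_iff)
    qed
  qed
qed

section \<open>An effective enumeration of the compressible strings\<close>

lemma semidecidable_Theta_set:
  assumes "prefix_free_machine V"
  shows "semidecidable (\<lambda>x. str_of x \<in> Theta_set V)"
  unfolding Theta_set_iff
proof -
  have "(\<exists>p. V p = Some (str_of x) \<and> length p < length (str_of x)) \<longleftrightarrow>
      (\<exists>p. V (str_of p) = Some (str_of x) \<and> code_length p < code_length x)" for x
    by (metis length_str_of str_of_str_nat)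
  moreover have "semidecidable (\<lambda>x. \<exists>p. V (str_of p) = Some (str_of x) \<and> code_length p < code_length x)"
    by (intro semidecidable_ex semidecidable_conj;
        (intro semidecidable_comp2[OF semidecidable_machine[OF assms]] recursive_intros
         | intro semidecidable_decidable recursive_intros))
  ultimately show "semidecidable (\<lambda>x. \<exists>p. V p = Some (str_of x) \<and> length p < length (str_of x))"
    by (simp only:)
qed

text \<open>\<open>g\<close> lists the codes of the elements of \<open>Theta_set V\<close>, each exactly once and shifted by one;
  the value 0 marks a stage at which nothing is listed.\<close>

locale theta_enumeration =
  fixes V :: "bool list \<Rightarrow> bool list option" and T :: real and g :: "nat \<Rightarrow> nat"
    and W :: "nat \<Rightarrow> nat \<Rightarrow> nat"
  assumes V: "prefix_free_machine V" and T: "0 < T" "T \<le> 1"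
    and g: "recursive g" "\<And>t s. g t = Suc s \<Longrightarrow> str_of s \<in> Theta_set V"
      "\<And>s. str_of s \<in> Theta_set V \<Longrightarrow> \<exists>t. g t = Suc s"
      "\<And>t t' s. g t = Suc s \<Longrightarrow> g t' = Suc s \<Longrightarrow> t = t'"
    and W: "recursive (\<lambda>z. W (pfst z) (psnd z))"
      "\<And>L N. real (W L N) < 2 powr (real N - real L / T)"
      "\<And>L N. 2 powr (real N - real L / T) < real (W L N) + 2"
begin

definition len :: "nat \<Rightarrow> nat" where "len i = code_length (g i - 1)"

definition u :: "nat \<Rightarrow> real" where "u i = (if g i = 0 then 0 else 2 powr (- real (len i) / T))"

definition w :: "nat \<Rightarrow> nat \<Rightarrow> nat" where "w i N = (if g i = 0 then 0 else W (len i) N)"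

lemma u_nonneg: "0 \<le> u i"
  by (simp add: u_def)

lemma recursive_w [recursive_intros]:
  assumes "recursive a" "recursive b"
  shows "recursive (\<lambda>x. w (a x) (b x))"
proof -
  have "recursive (\<lambda>x. (\<lambda>z. W (pfst z) (psnd z)) (pair (len (a x)) (b x)))"
    unfolding len_def
    by (intro recursive_comp[OF W(1)] recursive_intros assms recursive_comp[OF g(1)])
  then have "recursive (\<lambda>x. W (len (a x)) (b x))" by simp
  then show ?thesis unfolding w_def
    by (intro recursive_intros recursive_comp[OF g(1)] assms)
qed

lemma w_bounds: "real (w i N) \<le> 2 ^ N * u i" "2 ^ N * u i \<le> real (w i N) + 2"
proof -
  have "2 powr (real N - real (len i) / T) = 2 ^ N * 2 powr (- real (len i) / T)"
    by (simp add: powr_diff powr_minus powr_realpow divide_inverse flip: powr_minus)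
  then show "real (w i N) \<le> 2 ^ N * u i" "2 ^ N * u i \<le> real (w i N) + 2"
    using W(2)[of "len i" N] W(3)[of N "len i"] by (auto simp: w_def u_def)
qed

lemma listed: "bij_betw (\<lambda>i. str_of (g i - 1)) {i. g i \<noteq> 0} (Theta_set V)"
proof (rule bij_betwI')
  fix i j assume ij: "i \<in> {i. g i \<noteq> 0}" "j \<in> {i. g i \<noteq> 0}"
  show "str_of (g i - 1) = str_of (g j - 1) \<longleftrightarrow> i = j"
  proof
    assume "str_of (g i - 1) = str_of (g j - 1)"
    then have "g i - 1 = g j - 1" by (metis str_nat_str_of)
    then have "g i = Suc (g i - 1)" "g j = Suc (g i - 1)" using ij by auto
    then show "i = j" by (rule g(4))
  qed simp
next
  fix i assume "i \<in> {i. g i \<noteq> 0}"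
  then show "str_of (g i - 1) \<in> Theta_set V" by (intro g(2)[of i]) simp
next
  fix s assume "s \<in> Theta_set V"
  then obtain t where "g t = Suc (str_nat s)" using g(3)[of "str_nat s"] by auto
  then show "\<exists>i\<in>{i. g i \<noteq> 0}. s = str_of (g i - 1)" by (intro bexI[of _ t]) auto
qed

lemma kraft_listed: "(\<Sum>i<t. if g i = 0 then 0 else (1 / 2) ^ len i) \<le> (1 / 2 :: real)"
proof -
  define I where "I = {i. i < t \<and> g i \<noteq> 0}"
  define s where "s i = str_of (g i - 1)" for i
  have inj: "inj_on s I" using listed unfolding bij_betw_def s_def I_def by (auto elim: inj_on_subset)
  have sub: "s ` I \<subseteq> Theta_set V" using listed unfolding bij_betw_def s_def I_def by auto
  have "(\<Sum>i<t. if g i = 0 then 0 else (1 / 2 :: real) ^ len i) = (\<Sum>i\<in>I. (1 / 2) ^ len i)"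
    unfolding I_def by (intro sum.mono_neutral_cong_right) auto
  also have "\<dots> = (\<Sum>x\<in>s ` I. (1 / 2) ^ length x)"
    unfolding sum.reindex[OF inj] by (simp add: s_def len_def length_str_of)
  also have "\<dots> \<le> 1 / 2" by (rule Theta_set_kraft[OF V _ sub]) (simp add: I_def)
  finally show ?thesis .
qed

lemma Theta_summable: "Theta_term T summable_on Theta_set V"
proof (rule nonneg_bdd_above_summable_on)
  show "0 \<le> Theta_term T s" for s by (simp add: Theta_term_def)
  show "bdd_above (sum (Theta_term T) ` {F. F \<subseteq> Theta_set V \<and> finite F})"
  proof (rule bdd_aboveI2)
    fix F assume F: "F \<in> {F. F \<subseteq> Theta_set V \<and> finite F}"
    have "Theta_term T s \<le> (1 / 2) ^ length s" for s
    proof -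
      have "real (length s) \<le> real (length s) / T"
        using T by (simp add: le_divide_eq mult_left_le)
      then have "2 powr (- real (length s) / T) \<le> 2 powr (- real (length s))" by simp
      also have "\<dots> = (1 / 2) ^ length s" by (simp add: powr_minus_divide powr_realpow power_one_over)
      finally show ?thesis by (simp add: Theta_term_def)
    qed
    then have "sum (Theta_term T) F \<le> (\<Sum>s\<in>F. (1 / 2) ^ length s)" by (intro sum_mono)
    also have "\<dots> \<le> 1 / 2" using Theta_set_kraft[OF V, of F] F by simp
    finally show "sum (Theta_term T) F \<le> 1 / 2" .
  qed
qed

lemma u_sums: "u sums Theta V T"
proof -
  have "(Theta_term T has_sum Theta V T) (Theta_set V)"
    unfolding Theta_def by (rule has_sum_infsum[OF Theta_summable])
  then have "((\<lambda>i. Theta_term T (str_of (g i - 1))) has_sum Theta V T) {i. g i \<noteq> 0}"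
    using has_sum_reindex_bij_betw[OF listed] by blast
  also have "?this \<longleftrightarrow> (u has_sum Theta V T) UNIV"
    by (rule has_sum_cong_neutral) (auto simp: u_def Theta_term_def len_def length_str_of)
  finally show ?thesis by (rule has_sum_imp_sums)
qed

lemma sum_u_le: "(\<Sum>i<t. u i) \<le> Theta V T"
  using sum_le_suminf[OF sums_summable[OF u_sums], of "{..<t}"] u_nonneg sums_unique[OF u_sums] by auto

section \<open>Effective lower bounds and left-computability\<close>

definition approx :: "nat \<Rightarrow> nat" where "approx N = (\<Sum>i<N. w i N)"

lemma recursive_approx [recursive_intros]:
  assumes "recursive f"
  shows "recursive (\<lambda>x. approx (f x))"
  unfolding approx_def by (intro recursive_intros assms recursive_comp[OF assms])

lemma approx_le: "real (approx N) / 2 ^ N \<le> (\<Sum>i<N. u i)"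
proof -
  have "real (approx N) \<le> (\<Sum>i<N. 2 ^ N * u i)"
    unfolding approx_def of_nat_sum by (intro sum_mono w_bounds)
  also have "\<dots> = (\<Sum>i<N. u i) * 2 ^ N" by (simp add: sum_distrib_left mult.commute)
  finally show ?thesis by (subst pos_divide_le_eq) simp_all
qed

lemma approx_ge: "(\<Sum>i<N. u i) - 2 * real N / 2 ^ N \<le> real (approx N) / 2 ^ N"
proof -
  have "(\<Sum>i<N. 2 ^ N * u i) \<le> (\<Sum>i<N. real (w i N) + 2)"
    by (intro sum_mono w_bounds)
  also have "\<dots> = real (approx N) + 2 * real N"
    unfolding approx_def by (simp add: sum.distrib)
  finally have "(\<Sum>i<N. u i) * 2 ^ N \<le> real (approx N) + 2 * real N"
    by (simp add: sum_distrib_left mult.commute)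
  then have "(\<Sum>i<N. u i) \<le> (real (approx N) + 2 * real N) / 2 ^ N" by (subst pos_le_divide_eq) simp_all
  then show ?thesis by (simp add: add_divide_distrib)
qed

text \<open>Each of the \<open>N\<close> terms is off by at most \<open>2 / 2 ^ N\<close>, so the
  total error tends to 0 while the partial sums converge.\<close>

lemma approx_tendsto: "(\<lambda>N. real (approx N) / 2 ^ N) \<longlonglongrightarrow> Theta V T"
proof (rule tendsto_sandwich)
  show "\<forall>\<^sub>F N in sequentially. (\<Sum>i<N. u i) - 2 * real N / 2 ^ N \<le> real (approx N) / 2 ^ N"
    using approx_ge by simp
  show "\<forall>\<^sub>F N in sequentially. real (approx N) / 2 ^ N \<le> (\<Sum>i<N. u i)"
    using approx_le by simp
  show "(\<lambda>N. \<Sum>i<N. u i) \<longlonglongrightarrow> Theta V T" using u_sums unfolding sums_def .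
  have "(\<lambda>N. real N * (1 / 2) ^ N) \<longlonglongrightarrow> 0" by (rule powser_times_n_limit_0) simp
  then have "(\<lambda>N. 2 * (real N * (1 / 2) ^ N)) \<longlonglongrightarrow> 2 * 0" by (rule tendsto_mult_left)
  then have "(\<lambda>N. 2 * real N / 2 ^ N) \<longlonglongrightarrow> 0" by (simp add: power_divide)
  from tendsto_diff[OF \<open>(\<lambda>N. \<Sum>i<N. u i) \<longlonglongrightarrow> Theta V T\<close> this]
  show "(\<lambda>N. (\<Sum>i<N. u i) - 2 * real N / 2 ^ N) \<longlonglongrightarrow> Theta V T" by simp
qed

text \<open>The numerator \<open>1 - 2 * approx N\<close> is odd, so the fraction below is in lowest terms.\<close>

lemma Theta_left_computable: "left_computable (Theta V T)"
proof -
  define f where "f N = Fract (1 - 2 * int (approx N)) (2 ^ Suc N)" for N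
  have quot: "quotient_of (f N) = (1 - 2 * int (approx N), 2 ^ Suc N)" for N
  proof -
    have "coprime (1 - 2 * int (approx N)) (2 ^ Suc N)"
      unfolding coprime_power_right_iff coprime_right_2_iff_odd by simp
    then show ?thesis unfolding f_def quotient_of_Fract by (intro normalize_stable) simp_all
  qed
  have real_f: "real_of_rat (f N) = 1 / 2 ^ Suc N - real (approx N) / 2 ^ N" for N
    by (simp add: f_def of_rat_rat field_simps)
  \<comment> \<open>\<open>int_encode\<close> doubles nonnegative integers and sends a negative
    \<open>- m\<close> to \<open>2 * m - 1\<close>; the numerator is positive only for
    \<open>a = 0\<close>, where it is 1.\<close>
  have enc: "int_encode (1 - 2 * int a) = (if a = 0 then 2 else 4 * a - 3)" for a
    by (auto simp: int_encode_def sum_encode_def nat_diff_distrib nat_mult_distrib)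
  have "total_recursive_rat f"
  proof -
    have "recursive (\<lambda>N. if approx N = 0 then 2 else 4 * approx N - 3)" by (intro recursive_intros)
    then obtain ra where ra: "\<And>N. eval ra [N] (if approx N = 0 then 2 else 4 * approx N - 3)"
      unfolding recursive_def by blast
    have "recursive (\<lambda>N. 2 ^ Suc N)" by (intro recursive_intros)
    then obtain rb where rb: "\<And>N. eval rb [N] (2 ^ Suc N)" unfolding recursive_def by blast
    have "nat (2 ^ Suc N) = 2 ^ Suc N" for N using nat_power_eq[of 2 "Suc N"] by (simp del: power_Suc)
    then show ?thesis unfolding total_recursive_rat_def quot fst_conv snd_conv enc
      using ra rb by (intro exI[of _ ra] exI[of _ rb]) (simp only: simp_thms)
  qed
  moreover have "- Theta V T \<le> real_of_rat (f N)" for N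
  proof -
    have "real (approx N) / 2 ^ N \<le> Theta V T" using approx_le[of N] sum_u_le[of N] by linarith
    moreover have "(0::real) \<le> 1 / 2 ^ Suc N" by simp
    ultimately show ?thesis unfolding real_f by linarith
  qed
  moreover have "(\<lambda>N. real_of_rat (f N)) \<longlonglongrightarrow> - Theta V T"
  proof -
    have "(\<lambda>N. (1 / 2 :: real) ^ N) \<longlonglongrightarrow> 0" by (rule LIMSEQ_power_zero) simp
    from LIMSEQ_Suc[OF this] have "(\<lambda>N. 1 / 2 ^ Suc N :: real) \<longlonglongrightarrow> 0" by (simp add: power_divide)
    from tendsto_diff[OF this approx_tendsto] show ?thesis unfolding real_f by simp
  qed
  ultimately show ?thesis unfolding left_computable_def right_computable_def by blast
qed

end

section \<open>Weak Chaitin randomness\<close>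

lemma msb_string_mod: "msb_string n (j mod 2 ^ n) = msb_string n j"
proof -
  have "odd (j mod 2 ^ n div 2 ^ m) = odd (j div 2 ^ m)" if "m < n" for m
    using that unfolding take_bit_eq_mod[symmetric] bit_iff_odd[symmetric] by (simp add: bit_take_bit_iff)
  then show ?thesis by (auto simp: msb_string_def)
qed

text \<open>The string determines \<open>n\<close> and the last \<open>n\<close> bits of
  \<open>j\<close>, the quotient determines the rest. In the randomness proof the quotient is the
  integer part of the real, which the bits do not record.\<close>

lemma msb_code_inj:
  assumes "msb_code n j = msb_code m k" "j div 2 ^ n = k div 2 ^ m"
  shows "n = m" "j = k"
proof -
  have eq: "msb_string n j = msb_string m k" using arg_cong[OF assms(1), of str_of] by simp
  from arg_cong[OF eq, of length] show nm: "n = m" by simp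
  have "msb_string n (j mod 2 ^ n) = msb_string n (k mod 2 ^ n)" using eq nm by (simp add: msb_string_mod)
  then have "j mod 2 ^ n = k mod 2 ^ n" by (rule msb_string_inj) simp_all
  then show "j = k" using assms(2) nm by (metis div_mult_mod_eq)
qed

lemma Hc_ge:
  assumes "\<And>p. C p = Some s \<Longrightarrow> x \<le> real (length p)"
  shows "ereal x \<le> ereal_of_enat (Hc C s)"
proof (cases "Hc C s")
  case (enat n)
  then have "Hc C s < enat (Suc n)" by simp
  then obtain p where p: "C p = Some s" "length p < Suc n" unfolding Hc_def by (auto simp: INF_less_iff)
  then have "x \<le> real n" using assms[OF p(1)] by linarith
  then show ?thesis using enat by simp
qed simp

text \<open>The domain of \<open>C\<close> is contained in that of \<open>U\<close>, so
  prefix-freeness is inherited.\<close>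

lemma machine_postcompose:
  assumes U: "prefix_free_machine U"
  obtains C where "prefix_free_machine C"
    "\<And>p y. C p = Some y \<longleftrightarrow> (\<exists>x. U p = Some x \<and> eval r [str_nat x] (str_nat y))"
proof -
  define Q where "Q p y \<longleftrightarrow> (\<exists>x. U (str_of p) = Some (str_of x) \<and> eval r [x] y)" for p y
  have Q: "Q (str_nat p) (str_nat y) \<longleftrightarrow> (\<exists>x. U p = Some x \<and> eval r [str_nat x] (str_nat y))" for p y
    unfolding Q_def str_of_str_nat by (metis str_nat_str_of str_of_str_nat)
  obtain C where C: "prefix_free_machine C" "\<And>p y. C p = Some y \<longleftrightarrow> Q (str_nat p) (str_nat y)"
  proof (rule machine_of_relation[of Q])
    show "semidecidable (\<lambda>z. Q (pfst z) (psnd z))" unfolding Q_def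
      by (intro semidecidable_ex semidecidable_conj
          semidecidable_comp2[OF semidecidable_machine[OF U]]
          semidecidable_comp2[where P = "\<lambda>a b. eval r [a] b", OF semidecidable_eval] recursive_intros)
    show "y = y'" if "Q p y" "Q p y'" for p y y'
    proof -
      from that obtain x x' where x: "U (str_of p) = Some (str_of x)" "eval r [x] y"
        and x': "U (str_of p) = Some (str_of x')" "eval r [x'] y'" unfolding Q_def by blast
      then have "str_of x = str_of x'" by simp
      then have "x = x'" by (metis str_nat_str_of)
      then show ?thesis using x(2) x'(2) eval_deterministic by blast
    qed
    show "p = q" if "Q (str_nat p) y" "Q (str_nat q) y'" "prefix p q" for p q y y'
      using that prefix_free_machineD[OF U _ _ that(3)] unfolding Q_def by auto
  qed blast
  from that[OF C(1)] C(2) show thesis unfolding Q by blast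
qed

lemma nat_floor_power_div:
  fixes \<alpha> :: real
  assumes "0 \<le> \<alpha>"
  shows "nat \<lfloor>2 ^ n * \<alpha>\<rfloor> div 2 ^ n = nat \<lfloor>\<alpha>\<rfloor>"
proof -
  have "\<lfloor>\<alpha>\<rfloor> = \<lfloor>2 ^ n * \<alpha> / real_of_int (2 ^ n)\<rfloor>" by simp
  also have "\<dots> = \<lfloor>2 ^ n * \<alpha>\<rfloor> div 2 ^ n" by (rule floor_divide_real_eq_div) simp
  finally have "nat \<lfloor>\<alpha>\<rfloor> = nat (\<lfloor>2 ^ n * \<alpha>\<rfloor> div 2 ^ n)" by simp
  also have "\<dots> = nat \<lfloor>2 ^ n * \<alpha>\<rfloor> div 2 ^ n" using assms by (simp add: nat_div_distrib nat_power_eq)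
  finally show ?thesis by simp
qed

context theta_enumeration
begin

lemma Theta_nonneg: "0 \<le> Theta V T"
  using sum_u_le[of 0] by simp

text \<open>Once a rational lower bound of \<open>Theta V T\<close> is within \<open>2 / 2 ^ n\<close> of it, any string listed
  later has a term below \<open>2 / 2 ^ n\<close> and is therefore longer than \<open>T * (n - 1)\<close>.\<close>

lemma unlisted_short_string:
  assumes "real (nat \<lfloor>2 ^ n * Theta V T\<rfloor>) * 2 ^ N < real (approx N) * 2 ^ n + 2 ^ N"
    and "\<forall>i<N. g i \<noteq> Suc y" and "code_length y \<noteq> 0 \<Longrightarrow> real (code_length y) < T * real n - 1"
  shows "str_of y \<notin> Theta_set V"
proof
  assume y: "str_of y \<in> Theta_set V"
  \<comment> \<open>The empty string has no shorter program. This covers the case in which the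
    length \<open>l n - 2\<close> used below is truncated to 0.\<close>
  then have "length (str_of y) \<noteq> 0" unfolding Theta_set_iff by auto
  then have short: "real (code_length y) < T * real n - 1" using assms(3) by (simp add: length_str_of)
  obtain t where t: "g t = Suc y" using g(3)[OF y] by blast
  then have tN: "N \<le> t" using assms(2) by (metis not_le)
  have ut: "u t = 2 powr (- real (code_length y) / T)" using t by (simp add: u_def len_def)
  have "(\<Sum>i<N. u i) + u t \<le> (\<Sum>i<Suc t. u i)"
    using sum_mono2[of "{..<t}" "{..<N}" u] tN u_nonneg by simp
  also have "\<dots> \<le> Theta V T" by (rule sum_u_le)
  finally have "real (approx N) / 2 ^ N + u t \<le> Theta V T" using approx_le[of N] by linarith
  moreover have "real (nat \<lfloor>2 ^ n * Theta V T\<rfloor>) / 2 ^ n < real (approx N) / 2 ^ N + 1 / 2 ^ n"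
    using assms(1) by (simp add: field_simps)
  moreover have "Theta V T < real (nat \<lfloor>2 ^ n * Theta V T\<rfloor>) / 2 ^ n + 1 / 2 ^ n"
  proof -
    have "2 ^ n * Theta V T < real (nat \<lfloor>2 ^ n * Theta V T\<rfloor>) + 1" using Theta_nonneg by simp
    then show ?thesis by (simp add: field_simps)
  qed
  ultimately have "u t < 1 / 2 ^ n + 1 / 2 ^ n" by linarith
  then have "u t < 2 / 2 ^ n" by simp
  also have "2 / 2 ^ n = 2 powr (1 - real n)" by (simp add: powr_diff powr_realpow)
  finally have "- real (code_length y) / T < 1 - real n" unfolding ut by simp
  then have "T * (real n - 1) < real (code_length y)" using T by (simp add: field_simps)
  \<comment> \<open>By \<open>T \<le> 1\<close>, the bound \<open>T * (n - 1)\<close> is at least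
    \<open>T * n - 1\<close>.\<close>
  then show False using short T by (simp add: algebra_simps)
qed

text \<open>A machine \<open>C\<close> runs \<open>U\<close> on \<open>p\<close>, decodes the output
  into \<open>n\<close> and \<open>J\<close>, and searches for a stage \<open>N\<close> close enough
  to \<open>J\<close> together with a string \<open>y\<close> of length \<open>l n - 2\<close> not
  listed by then. Every such \<open>y\<close> is incompressible for \<open>V\<close>, so optimality
  of \<open>V\<close> against \<open>C\<close> bounds \<open>l n - 2\<close> by
  \<open>length p + d\<close>. \<open>U\<close> supplies the programs and \<open>V\<close> measures
  \<open>y\<close>, which lets the two machines differ.\<close>

lemma Theta_weakly_random:
  assumes U: "optimal_machine U" and optV: "optimal_machine V" and compT: "computable_real T"
  shows "weakly_Chaitin_random U T (Theta V T)"
proof -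
  define \<alpha> where "\<alpha> = Theta V T"
  \<comment> \<open>The bits determine \<open>\<alpha>\<close> only up to its integer part, so this
    one number is built into the machine.\<close>
  define K where "K = nat \<lfloor>\<alpha>\<rfloor>"
  obtain l where l: "recursive l" "\<And>n. \<bar>real (l n) - T * real n\<bar> < 1"
    using recursive_multiple_approximation[OF compT T(1)] by metis
  \<comment> \<open>The inequality says \<open>J / 2 ^ n < approx N / 2 ^ N + 1 / 2 ^ n\<close>.
    When positive, the length \<open>l n - 2\<close> is below \<open>T * n - 1\<close>, since
    \<open>l n < T * n + 1\<close>.\<close>
  define R where "R x y \<longleftrightarrow> (\<exists>n J N. x = msb_code n J \<and> J div 2 ^ n = K \<and>
     J * 2 ^ N < approx N * 2 ^ n + 2 ^ N \<and> code_length y = l n - 2 \<and> (\<forall>i<N. g i \<noteq> Suc y))" for x y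
  have "semidecidable (\<lambda>z. R (pfst z) (psnd z))" unfolding R_def
    by (intro semidecidable_ex semidecidable_decidable recursive_intros
        recursive_comp[OF l(1)] recursive_comp[OF g(1)])
  then obtain r where r: "\<And>x y. eval r [x] y \<Longrightarrow> R x y" "\<And>x y. R x y \<Longrightarrow> \<exists>y'. eval r [x] y'"
    using semidecidable_uniformization by metis
  have pU: "prefix_free_machine U" using U unfolding optimal_machine_def by blast
  obtain C where C: "prefix_free_machine C"
    "\<And>p y. C p = Some y \<longleftrightarrow> (\<exists>x. U p = Some x \<and> eval r [str_nat x] (str_nat y))"
    using machine_postcompose[OF pU] by metis
  obtain d where d: "\<And>p y. C p = Some y \<Longrightarrow> Hc V y \<le> enat (length p + d)"
    using optimal_machineD[OF optV C(1)] by metis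
  \<comment> \<open>In \<open>d + 3\<close>, \<open>d\<close> is the cost of simulating
    \<open>C\<close> on \<open>V\<close>, 2 is what the length of \<open>y\<close> lacks from
    \<open>l n\<close>, and 1 bounds the distance of \<open>l n\<close> from
    \<open>T * n\<close>.\<close>
  have bound: "T * real n - real (d + 3) \<le> real (length p)" if p: "U p = Some (real_bits \<alpha> n)" for n p
  proof -
    define J where "J = nat \<lfloor>2 ^ n * \<alpha>\<rfloor>"
    have \<alpha>: "0 \<le> \<alpha>" using Theta_nonneg by (simp add: \<alpha>_def)
    have x: "str_nat (real_bits \<alpha> n) = msb_code n J"
      unfolding J_def real_bits_eq_msb_string[OF \<alpha>] by (rule str_nat_msb_string)
    have JK: "J div 2 ^ n = K" unfolding J_def K_def by (rule nat_floor_power_div[OF \<alpha>])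
    have "\<exists>y. R (msb_code n J) y"
    proof -
      have "\<alpha> - 1 / 2 ^ n < \<alpha>" by simp
      then have "\<forall>\<^sub>F N in sequentially. \<alpha> - 1 / 2 ^ n < real (approx N) / 2 ^ N"
        using order_tendstoD(1)[OF approx_tendsto] unfolding \<alpha>_def by blast
      then obtain N where N: "\<alpha> - 1 / 2 ^ n < real (approx N) / 2 ^ N"
        unfolding eventually_sequentially by blast
      have "real J \<le> 2 ^ n * \<alpha>" unfolding J_def using \<alpha> by simp
      then have "real J / 2 ^ n \<le> \<alpha>" by (simp add: divide_le_eq mult.commute)
      with N have "real J / 2 ^ n < real (approx N) / 2 ^ N + 1 / 2 ^ n" by linarith
      then have "real J * 2 ^ N < real (approx N) * 2 ^ n + 2 ^ N" by (simp add: field_simps)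
      then have "real (J * 2 ^ N) < real (approx N * 2 ^ n + 2 ^ N)" by simp
      then have J: "J * 2 ^ N < approx N * 2 ^ n + 2 ^ N" by (simp only: of_nat_less_iff)
      \<comment> \<open>An incompressible string is never listed, so the search succeeds. It may
        return a different string, which the condition on \<open>N\<close> makes incompressible as
        well.\<close>
      obtain s where s: "length s = l n - 2" "s \<notin> Theta_set V" using incompressible_string[OF V] by metis
      have "\<forall>i<N. g i \<noteq> Suc (str_nat s)" using g(2)[of _ "str_nat s"] s(2) by auto
      then show ?thesis unfolding R_def using J JK s(1)
        by (intro exI[of _ "str_nat s"] exI[of _ n] exI[of _ J] exI[of _ N]) simp
    qed
    then obtain y where y: "eval r [msb_code n J] y" using r(2) by blast
    from r(1)[OF y] obtain n' J' N where R: "msb_code n J = msb_code n' J'" "J' div 2 ^ n' = K"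
        "J' * 2 ^ N < approx N * 2 ^ n' + 2 ^ N" "code_length y = l n' - 2" "\<forall>i<N. g i \<noteq> Suc y"
      unfolding R_def by blast
    have eq: "n' = n" "J' = J" using msb_code_inj[OF R(1)] R(2) JK by simp_all
    have "str_of y \<notin> Theta_set V"
    proof (rule unlisted_short_string)
      have "real (J * 2 ^ N) < real (approx N * 2 ^ n + 2 ^ N)"
        using R(3) unfolding eq by (simp only: of_nat_less_iff)
      then show "real (nat \<lfloor>2 ^ n * Theta V T\<rfloor>) * 2 ^ N < real (approx N) * 2 ^ n + 2 ^ N"
        unfolding J_def \<alpha>_def by simp
      show "real (code_length y) < T * real n - 1" if "code_length y \<noteq> 0"
      proof -
        have "real (code_length y) = real (l n) - 2" using that R(4) unfolding eq by simp
        then show ?thesis using l(2)[of n] by linarith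
      qed
    qed (rule R(5))
    then have "enat (l n - 2) \<le> Hc V (str_of y)"
      using R(4) unfolding Theta_set_def eq by (simp add: length_str_of not_less)
    also have "C p = Some (str_of y)" unfolding C(2) using p y x by auto
    then have "Hc V (str_of y) \<le> enat (length p + d)" by (rule d)
    finally have "l n - 2 \<le> length p + d" by simp
    then have "real (l n) \<le> real (length p) + real d + 2" by linarith
    then show ?thesis using l(2)[of n] by simp
  qed
  show ?thesis unfolding weakly_Chaitin_random_def \<alpha>_def[symmetric]
    by (intro exI[of _ "d + 3"] allI impI Hc_ge bound)
qed

end

section \<open>Strict compressibility\<close>

text \<open>A pair code is at least as large as either component, so the codes below
  \<open>K\<close> decode into the square of side \<open>K\<close>. This turns Kraft sums over coded
  requests into iterated sums.\<close>

lemma sum_pair_le: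
  fixes f :: "nat \<Rightarrow> nat \<Rightarrow> real"
  assumes "\<And>a b. 0 \<le> f a b"
  shows "(\<Sum>k<K. f (pfst k) (psnd k)) \<le> (\<Sum>a<K. \<Sum>b<K. f a b)"
proof -
  have inj: "inj_on prod_decode {..<K}" by (rule inj_prod_decode)
  have le: "pfst k \<le> k \<and> psnd k \<le> k" for k
    using le_prod_encode_1[of "pfst k" "psnd k"] le_prod_encode_2[of "psnd k" "pfst k"]
    by (metis pair_def pair_pfst_psnd)
  have "(\<Sum>k<K. f (pfst k) (psnd k)) = (\<Sum>k<K. (\<lambda>(a, b). f a b) (prod_decode k))"
    by (simp add: pfst_def psnd_def case_prod_unfold)
  also have "\<dots> = (\<Sum>(a, b)\<in>prod_decode ` {..<K}. f a b)"
    by (simp add: sum.reindex[OF inj])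
  also have "\<dots> \<le> (\<Sum>(a, b)\<in>{..<K} \<times> {..<K}. f a b)"
  proof (rule sum_mono2)
    show "prod_decode ` {..<K} \<subseteq> {..<K} \<times> {..<K}"
    proof
      fix z assume "z \<in> prod_decode ` {..<K}"
      then obtain k where "k < K" "z = (pfst k, psnd k)" by (auto simp: pfst_def psnd_def)
      then show "z \<in> {..<K} \<times> {..<K}" using le[of k] by auto
    qed
  qed (auto simp: assms)
  also have "\<dots> = (\<Sum>a<K. \<Sum>b<K. f a b)" by (rule sum.cartesian_product[symmetric])
  finally show ?thesis .
qed

text \<open>A step of size at least 1 pays for both a change of the floor and the growth of the fractional
  part; a smaller step that changes the floor decreases the fractional part by 1.\<close>

lemma floor_changes_bound:
  fixes x :: "nat \<Rightarrow> real"
  assumes x: "\<And>i. 0 \<le> x i"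
  defines "X \<equiv> \<lambda>t. \<Sum>i<t. x i"
  shows "(\<Sum>t<Suc M. of_bool (t = 0 \<or> \<lfloor>X t\<rfloor> \<noteq> \<lfloor>X (t - 1)\<rfloor>)) + frac (X M) \<le> 1 + 2 * (\<Sum>i<M. min 1 (x i))"
proof (induction M)
  case 0
  show ?case by (simp add: X_def)
next
  case (Suc M)
  have XS: "X (Suc M) = X M + x M" by (simp add: X_def)
  have "of_bool (\<lfloor>X (Suc M)\<rfloor> \<noteq> \<lfloor>X M\<rfloor>) + frac (X (Suc M)) \<le> frac (X M) + 2 * min 1 (x M)"
  proof (cases "\<lfloor>X (Suc M)\<rfloor> = \<lfloor>X M\<rfloor>")
    case True
    then have "frac (X (Suc M)) = frac (X M) + x M" by (simp add: frac_def XS)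
    moreover from this have "x M < 1" using frac_lt_1[of "X (Suc M)"] frac_ge_0[of "X M"] by linarith
    ultimately show ?thesis using True x[of M] by simp
  next
    case False
    have "\<lfloor>X M\<rfloor> \<le> \<lfloor>X (Suc M)\<rfloor>" using x[of M] by (intro floor_mono) (simp add: XS)
    with False have "\<lfloor>X M\<rfloor> + 1 \<le> \<lfloor>X (Suc M)\<rfloor>" by simp
    then have "real_of_int \<lfloor>X M\<rfloor> + 1 \<le> real_of_int \<lfloor>X (Suc M)\<rfloor>" by linarith
    then have "frac (X (Suc M)) \<le> frac (X M) + x M - 1" unfolding frac_def XS by linarith
    then have "1 + frac (X (Suc M)) \<le> frac (X M) + 2 * min 1 (x M)"
      using x[of M] frac_lt_1[of "X (Suc M)"] frac_ge_0[of "X M"] by linarith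
    then show ?thesis using False by simp
  qed
  then show ?case using Suc.IH by simp
qed

lemma sum_geometric_inj_le:
  fixes \<beta> :: real
  assumes "0 \<le> \<beta>" "\<beta> < 1" "finite A" "inj_on h A"
  shows "(\<Sum>n\<in>A. \<beta> ^ h n) \<le> 1 / (1 - \<beta>)"
proof -
  have "(\<Sum>n\<in>A. \<beta> ^ h n) = (\<Sum>j\<in>h ` A. \<beta> ^ j)" by (simp add: sum.reindex[OF assms(4)])
  also have "\<dots> \<le> (\<Sum>j. \<beta> ^ j)"
    by (rule sum_le_suminf) (use assms in \<open>auto intro: summable_geometric\<close>)
  also have "\<dots> = 1 / (1 - \<beta>)" using assms by (intro suminf_geometric) simp
  finally show ?thesis .
qed

text \<open>Put \<open>x = L / T\<close>. As a function of real \<open>n\<close> the summand peaks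
  at \<open>n = x\<close> with the value \<open>2 powr (- L)\<close> and decays at rate
  \<open>1 - T\<close> to the left and \<open>T\<close> to the right. Since \<open>T < 1\<close>,
  both rates are positive and geometric series dominate; at \<open>T = 1\<close> the left side would
  be flat and the sum would gain a factor of order \<open>L\<close>.\<close>

lemma damped_geometric_bound:
  assumes T: "0 < T" "T < 1"
  obtains D where "D > 0"
    "\<And>K L. (\<Sum>n<K. 2 powr (- T * real n) * min 1 (2 ^ n * 2 powr (- real L / T))) \<le> D * (1 / 2) ^ L"
proof -
  define r where "r = min T (1 - T)"
  have r: "0 < r" "r \<le> T" "r \<le> 1 - T" "r \<le> 1" using T by (auto simp: r_def)
  define \<beta> where "\<beta> = 2 powr - r"
  have \<beta>: "0 < \<beta>" "\<beta> < 1" using r by (auto simp: \<beta>_def powr_less_one)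
  have \<beta>_power: "\<beta> ^ k = 2 powr (- r * real k)" for k
    unfolding \<beta>_def by (simp add: powr_power mult.commute)
  show thesis
  proof (rule that[of "2 * (2 / (1 - \<beta>))"])
    show "2 * (2 / (1 - \<beta>)) > 0" using \<beta> by simp
    fix K L :: nat
    define x where "x = real L / T"
    define m where "m = nat \<lfloor>x\<rfloor>"
    have "0 \<le> x" using T by (simp add: x_def)
    then have m: "real m \<le> x" "x < real m + 1" by (auto simp: m_def)
    have L: "(1 / 2) ^ L = 2 powr (- T * x)" using T by (simp add: x_def powr_minus_divide powr_realpow power_one_over)
    have term_le: "2 powr (- T * real n) * min 1 (2 ^ n * 2 powr (- real L / T))
        \<le> 2 * (1 / 2) ^ L * (of_bool (n \<le> m) * \<beta> ^ (m - n) + of_bool (m \<le> n) * \<beta> ^ (n - m))" for n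
    proof -
      have pw: "2 ^ n * 2 powr (- real L / T) = 2 powr (real n - x)"
        by (simp add: x_def powr_diff powr_minus_divide powr_realpow)
      have "2 powr (- T * real n) * min 1 (2 ^ n * 2 powr (- real L / T)) \<le> 2 powr (- T * x - r * \<bar>real n - x\<bar>)"
      proof (cases "x \<le> real n")
        case True
        have "2 powr (- T * real n) * min 1 (2 ^ n * 2 powr (- real L / T)) \<le> 2 powr (- T * real n) * 1"
          by (intro mult_left_mono) auto
        also have "\<dots> \<le> 2 powr (- T * x - r * \<bar>real n - x\<bar>)"
        proof -
          have "r * (real n - x) \<le> T * (real n - x)" using True r by (intro mult_right_mono) auto
          then show ?thesis using True by (simp add: algebra_simps)
        qed
        finally show ?thesis .
      next
        case False
        have "2 powr (- T * real n) * min 1 (2 ^ n * 2 powr (- real L / T)) \<le> 2 powr (- T * real n) * 2 powr (real n - x)"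
          unfolding pw by (intro mult_left_mono) auto
        also have "\<dots> = 2 powr (- T * real n + (real n - x))" by (simp only: powr_add)
        also have "\<dots> \<le> 2 powr (- T * x - r * \<bar>real n - x\<bar>)"
        proof -
          have "r * (x - real n) \<le> (1 - T) * (x - real n)" using False r by (intro mult_right_mono) auto
          then show ?thesis using False by (simp add: algebra_simps)
        qed
        finally show ?thesis .
      qed
      \<comment> \<open>One of the truncated differences is 0, so their sum is the distance of
        \<open>m\<close> and \<open>n\<close>. Rounding \<open>x\<close> down to \<open>m\<close>
        changes the distance by at most 1, which by \<open>r \<le> 1\<close> costs a factor of at
        most 2.\<close>
      also have "\<dots> \<le> 2 powr (1 + (- T * x) + (- r * (real (m - n) + real (n - m))))"
      proof -
        have "real (m - n) + real (n - m) - 1 \<le> \<bar>real n - x\<bar>" using m by linarith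
        then have "r * (real (m - n) + real (n - m) - 1) \<le> r * \<bar>real n - x\<bar>"
          using r by (intro mult_left_mono) auto
        then show ?thesis using r by (simp add: algebra_simps)
      qed
      also have "\<dots> = 2 * (1 / 2) ^ L * \<beta> ^ (m - n) * \<beta> ^ (n - m)"
        unfolding powr_add L \<beta>_power distrib_left by simp
      also have "\<dots> = 2 * (1 / 2) ^ L * (\<beta> ^ (m - n) * \<beta> ^ (n - m))" by simp
      also have "\<dots> \<le> 2 * (1 / 2) ^ L * (of_bool (n \<le> m) * \<beta> ^ (m - n) + of_bool (m \<le> n) * \<beta> ^ (n - m))"
        using \<beta> by (intro mult_left_mono) (auto simp: le_diff_conv not_le)
      finally show ?thesis .
    qed
    have "(\<Sum>n<K. of_bool (n \<le> m) * \<beta> ^ (m - n)) = (\<Sum>n\<in>{n. n < K \<and> n \<le> m}. \<beta> ^ (m - n))"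
      by (intro sum.mono_neutral_cong_right) auto
    also have "\<dots> \<le> 1 / (1 - \<beta>)" using \<beta> by (intro sum_geometric_inj_le) (auto simp: inj_on_def)
    finally have s1: "(\<Sum>n<K. of_bool (n \<le> m) * \<beta> ^ (m - n)) \<le> 1 / (1 - \<beta>)" .
    have "(\<Sum>n<K. of_bool (m \<le> n) * \<beta> ^ (n - m)) = (\<Sum>n\<in>{n. n < K \<and> m \<le> n}. \<beta> ^ (n - m))"
      by (intro sum.mono_neutral_cong_right) auto
    also have "\<dots> \<le> 1 / (1 - \<beta>)" using \<beta> by (intro sum_geometric_inj_le) (auto simp: inj_on_def)
    finally have s2: "(\<Sum>n<K. of_bool (m \<le> n) * \<beta> ^ (n - m)) \<le> 1 / (1 - \<beta>)" .
    have "(\<Sum>n<K. 2 powr (- T * real n) * min 1 (2 ^ n * 2 powr (- real L / T)))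
        \<le> (\<Sum>n<K. 2 * (1 / 2) ^ L * (of_bool (n \<le> m) * \<beta> ^ (m - n) + of_bool (m \<le> n) * \<beta> ^ (n - m)))"
      by (rule sum_mono) (rule term_le)
    also have "\<dots> = 2 * (1 / 2) ^ L * ((\<Sum>n<K. of_bool (n \<le> m) * \<beta> ^ (m - n)) + (\<Sum>n<K. of_bool (m \<le> n) * \<beta> ^ (n - m)))"
      by (simp only: sum_distrib_left sum.distrib distrib_left)
    also have "\<dots> \<le> 2 * (1 / 2) ^ L * (1 / (1 - \<beta>) + 1 / (1 - \<beta>))"
      using s1 s2 by (intro mult_left_mono add_mono) auto
    also have "\<dots> = 2 * (2 / (1 - \<beta>)) * (1 / 2) ^ L" by simp
    finally show "(\<Sum>n<K. 2 powr (- T * real n) * min 1 (2 ^ n * 2 powr (- real L / T)))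
        \<le> 2 * (2 / (1 - \<beta>)) * (1 / 2) ^ L" .
  qed
qed

context theta_enumeration
begin

text \<open>Term \<open>i\<close> is rounded to \<open>n + i\<close> binary places once and for all.
  The partial sums thus grow with time, and in units of \<open>2 ^ - n\<close> the errors
  \<open>2 / 2 ^ i\<close> add up to at most 4.\<close>

definition step :: "nat \<Rightarrow> nat \<Rightarrow> real" where "step n i = real (w i (n + i)) / 2 ^ i"

definition level :: "nat \<Rightarrow> nat \<Rightarrow> nat" where
  "level n t = (\<Sum>i<t. w i (n + i) * 2 ^ (t - i)) div 2 ^ t"

text \<open>Stage 0 counts as an update so that the initial level is requested as well.\<close>

definition update :: "nat \<Rightarrow> nat \<Rightarrow> bool" where
  "update n t \<longleftrightarrow> t = 0 \<or> level n t \<noteq> level n (t - 1)"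

lemma step_nonneg: "0 \<le> step n i"
  by (simp add: step_def)

lemma step_bounds: "step n i \<le> 2 ^ n * u i" "2 ^ n * u i \<le> step n i + 2 * (1 / 2) ^ i"
proof -
  have "real (w i (n + i)) \<le> 2 ^ n * u i * 2 ^ i" "2 ^ n * u i * 2 ^ i \<le> real (w i (n + i)) + 2"
    using w_bounds(1)[of i "n + i"] w_bounds(2)[of "n + i" i] by (simp_all add: power_add ac_simps)
  then show "step n i \<le> 2 ^ n * u i" "2 ^ n * u i \<le> step n i + 2 * (1 / 2) ^ i"
    by (simp_all add: step_def field_simps power_one_over)
qed

lemma floor_step_sum: "\<lfloor>\<Sum>i<t. step n i\<rfloor> = int (level n t)"
proof -
  have "(\<Sum>i<t. step n i) = real (\<Sum>i<t. w i (n + i) * 2 ^ (t - i)) / real (2 ^ t)"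
    unfolding of_nat_sum sum_divide_distrib
  proof (intro sum.cong refl)
    fix i assume "i \<in> {..<t}"
    then have "(2::real) ^ t = 2 ^ i * 2 ^ (t - i)" by (simp flip: power_add)
    then show "step n i = real (w i (n + i) * 2 ^ (t - i)) / real (2 ^ t)" by (simp add: step_def)
  qed
  then show ?thesis unfolding level_def by (simp only: floor_divide_of_nat_eq)
qed

lemma recursive_level [recursive_intros]:
  assumes "recursive a" "recursive b"
  shows "recursive (\<lambda>x. level (a x) (b x))"
  unfolding level_def by (intro recursive_intros assms recursive_comp[OF assms(1)] recursive_comp[OF assms(2)])

lemma decidable_update [recursive_intros]:
  assumes "recursive a" "recursive b"
  shows "decidable (\<lambda>x. update (a x) (b x))"
  unfolding update_def by (intro recursive_intros assms)

text \<open>The 1 is the update at stage 0. The minimum is there because a listed string, however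
  large its step, moves the level at a single stage.\<close>

lemma count_updates: "(\<Sum>t<M. of_bool (update n t)) \<le> 1 + 2 * (\<Sum>i<M. min 1 (2 ^ n * u i))"
proof -
  have "(\<Sum>t<M. of_bool (update n t)) \<le> (\<Sum>t<Suc M. of_bool (update n t) :: real)" by simp
  also have "\<dots> = (\<Sum>t<Suc M. of_bool (t = 0 \<or> \<lfloor>\<Sum>i<t. step n i\<rfloor> \<noteq> \<lfloor>\<Sum>i<t - 1. step n i\<rfloor>))"
    unfolding update_def floor_step_sum of_nat_eq_iff ..
  also have "\<dots> \<le> 1 + 2 * (\<Sum>i<M. min 1 (step n i))"
    using floor_changes_bound[of "step n" M, OF step_nonneg] frac_ge_0[of "\<Sum>i<M. step n i"] by linarith
  also have "\<dots> \<le> 1 + 2 * (\<Sum>i<M. min 1 (2 ^ n * u i))"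
    by (intro add_left_mono mult_left_mono sum_mono min.mono step_bounds) auto
  finally show ?thesis .
qed

lemma last_update: "\<exists>t'\<le>t. update n t' \<and> level n t' = level n t"
proof (induction t)
  case 0
  show ?case by (simp add: update_def)
next
  case (Suc t)
  show ?case
  proof (cases "update n (Suc t)")
    case False
    then have "level n (Suc t) = level n t" by (simp add: update_def)
    then show ?thesis using Suc.IH le_SucI by metis
  qed blast
qed

text \<open>In the window of 6, 1 is for the tail of the series, 4 for the accumulated rounding and
  1 for the passage to floors.\<close>

lemma level_close:
  obtains t where "level n t \<le> nat \<lfloor>2 ^ n * Theta V T\<rfloor>" "nat \<lfloor>2 ^ n * Theta V T\<rfloor> < level n t + 6"
proof -
  have "Theta V T - 1 / 2 ^ n < Theta V T" by simp
  then have "\<forall>\<^sub>F t in sequentially. Theta V T - 1 / 2 ^ n < (\<Sum>i<t. u i)"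
    using order_tendstoD(1)[OF u_sums[unfolded sums_def]] by blast
  then obtain t where t: "Theta V T - 1 / 2 ^ n < (\<Sum>i<t. u i)"
    unfolding eventually_sequentially by blast
  have le: "(\<Sum>i<t. step n i) \<le> 2 ^ n * Theta V T"
  proof -
    have "(\<Sum>i<t. step n i) \<le> (\<Sum>i<t. 2 ^ n * u i)" by (intro sum_mono step_bounds)
    also have "\<dots> = 2 ^ n * (\<Sum>i<t. u i)" by (simp add: sum_distrib_left)
    also have "\<dots> \<le> 2 ^ n * Theta V T" by (intro mult_left_mono sum_u_le) simp
    finally show ?thesis .
  qed
  have ge: "2 ^ n * Theta V T - 5 < (\<Sum>i<t. step n i)"
  proof -
    have "2 ^ n * (Theta V T - 1 / 2 ^ n) < 2 ^ n * (\<Sum>i<t. u i)" using t by simp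
    then have "2 ^ n * Theta V T - 1 < (\<Sum>i<t. 2 ^ n * u i)" by (simp add: sum_distrib_left right_diff_distrib)
    also have "\<dots> \<le> (\<Sum>i<t. step n i + 2 * (1 / 2) ^ i)" by (intro sum_mono step_bounds)
    also have "\<dots> = (\<Sum>i<t. step n i) + 2 * (\<Sum>i<t. (1 / 2) ^ i)" by (simp add: sum.distrib sum_distrib_left)
    also have "(\<Sum>i<t. (1 / 2 :: real) ^ i) \<le> 2"
      using sum_geometric_inj_le[of "1 / 2" "{..<t}" "\<lambda>i. i"] by simp
    finally show ?thesis by simp
  qed
  have "int (level n t) \<le> \<lfloor>2 ^ n * Theta V T\<rfloor>" unfolding floor_step_sum[symmetric] by (rule floor_mono[OF le])
  moreover have "\<lfloor>2 ^ n * Theta V T\<rfloor> < int (level n t) + 6"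
    unfolding floor_step_sum[symmetric] using ge by linarith
  ultimately show thesis using that[of t] by linarith
qed

lemma update_weight_bound:
  assumes "T < 1" and l: "\<And>n. \<bar>real (l n) - T * real n\<bar> < 1"
  obtains c where "\<And>K. (\<Sum>n<K. (1 / 2) ^ l n * (\<Sum>t<K. of_bool (update n t))) \<le> (c :: real)"
proof -
  obtain D where D: "D > 0"
    "\<And>K L. (\<Sum>n<K. 2 powr (- T * real n) * min 1 (2 ^ n * 2 powr (- real L / T))) \<le> D * (1 / 2) ^ L"
    using damped_geometric_bound[OF T(1) assms(1)] by metis
  define \<rho> where "\<rho> = 2 powr (- T)"
  have \<rho>: "0 < \<rho>" "\<rho> < 1" using T by (auto simp: \<rho>_def powr_less_one)
  have \<rho>_power: "2 powr (- T * real n) = \<rho> ^ n" for n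
    unfolding \<rho>_def by (simp add: powr_power mult.commute)
  \<comment> \<open>\<open>l n\<close> exceeds \<open>T * n - 1\<close>, whence the factor
    2.\<close>
  have weight: "(1 / 2) ^ l n \<le> 2 * 2 powr (- T * real n)" for n
  proof -
    have "(1 / 2) ^ l n = 2 powr (- real (l n))" by (simp add: powr_minus_divide powr_realpow power_one_over)
    also have "\<dots> \<le> 2 powr (1 + - T * real n)" using l[of n] by simp
    also have "\<dots> = 2 * 2 powr (- T * real n)" by (simp add: powr_add powr_diff powr_minus_divide)
    finally show ?thesis .
  qed
  show thesis
  \<comment> \<open>The term \<open>1 / (1 - \<rho>)\<close> pays for the stage 0 updates of all
    \<open>n\<close>, the term with \<open>D\<close> for those caused by listed strings.\<close>
  proof (rule that[of "2 * (1 / (1 - \<rho>) + 2 * (D * (1 / 2)))"])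
    fix K
    have "(\<Sum>n<K. (1 / 2) ^ l n * (\<Sum>t<K. of_bool (update n t)))
        \<le> (\<Sum>n<K. 2 * 2 powr (- T * real n) * (1 + 2 * (\<Sum>i<K. min 1 (2 ^ n * u i))))"
      by (intro sum_mono mult_mono weight count_updates sum_nonneg) auto
    also have "\<dots> = 2 * ((\<Sum>n<K. \<rho> ^ n) + 2 * (\<Sum>n<K. \<Sum>i<K. 2 powr (- T * real n) * min 1 (2 ^ n * u i)))"
      unfolding \<rho>_power[symmetric]
      by (simp add: sum_distrib_left sum.distrib distrib_left mult.assoc mult.left_commute)
    also have "(\<Sum>n<K. \<rho> ^ n) \<le> 1 / (1 - \<rho>)" using \<rho> by (intro sum_geometric_inj_le) auto
    \<comment> \<open>Exchanging the sums collects, for each listed string, its cost over all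
      \<open>n\<close>, which is at most \<open>D\<close> times its Kraft weight.\<close>
    also have "(\<Sum>n<K. \<Sum>i<K. 2 powr (- T * real n) * min 1 (2 ^ n * u i))
        = (\<Sum>i<K. \<Sum>n<K. 2 powr (- T * real n) * min 1 (2 ^ n * u i))" by (rule sum.swap)
    also have "\<dots> \<le> (\<Sum>i<K. D * (if g i = 0 then 0 else (1 / 2) ^ len i))"
      by (intro sum_mono) (use D in \<open>auto simp: u_def\<close>)
    also have "\<dots> = D * (\<Sum>i<K. if g i = 0 then 0 else (1 / 2) ^ len i)" by (simp add: sum_distrib_left)
    also have "\<dots> \<le> D * (1 / 2)" using D(1) by (intro mult_left_mono kraft_listed) simp
    finally show "(\<Sum>n<K. (1 / 2) ^ l n * (\<Sum>t<K. of_bool (update n t))) \<le> 2 * (1 / (1 - \<rho>) + 2 * (D * (1 / 2)))"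
      by simp
  qed
qed

text \<open>Whenever \<open>level n\<close> changes, request the strings for the six numbers that may turn out to be
  \<open>\<lfloor>2 ^ n * Theta V T\<rfloor>\<close>, with length about \<open>T * n\<close>.\<close>

lemma Theta_strictly_compressible:
  assumes U: "optimal_machine U" and compT: "computable_real T" and "T < 1"
  shows "strictly_compressible U T (Theta V T)"
proof -
  obtain l where l: "recursive l" "\<And>n. \<bar>real (l n) - T * real n\<bar> < 1"
    using recursive_multiple_approximation[OF compT T(1)] by metis
  obtain c where c: "\<And>K. (\<Sum>n<K. (1 / 2) ^ l n * (\<Sum>t<K. of_bool (update n t))) \<le> (c :: real)"
    using update_weight_bound[OF \<open>T < 1\<close> l(2)] by metis
  obtain c' where c': "6 * c < 2 ^ c'" using real_arch_pow[of 2 "6 * c"] by auto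
  \<comment> \<open>A request \<open>k\<close> codes the number \<open>n\<close> of bits, a stage,
    and an offset below 6 to be added to the level.\<close>
  define P where "P k \<longleftrightarrow> psnd (psnd k) < 6 \<and> update (pfst k) (pfst (psnd k))" for k
  define y where "y k = msb_code (pfst k) (level (pfst k) (pfst (psnd k)) + psnd (psnd k))" for k
  have bound: "(\<Sum>k<K. if P k then (1 / 2) ^ l (pfst k) else 0) \<le> (2::real) ^ c'" for K
  proof -
    define f where "f n t e = (if e < 6 \<and> update n t then (1 / 2 :: real) ^ l n else 0)" for n t and e :: nat
    have "(\<Sum>e<K. f n t e) \<le> 6 * ((1 / 2) ^ l n * of_bool (update n t))" for n t
    proof -
      have "(\<Sum>e<K. f n t e) = (\<Sum>e\<in>{e. e < K \<and> e < 6}. (1 / 2) ^ l n * of_bool (update n t))"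
        unfolding f_def by (intro sum.mono_neutral_cong_right) auto
      also have "\<dots> = real (card {e. e < K \<and> e < 6}) * ((1 / 2) ^ l n * of_bool (update n t))" by simp
      also have "\<dots> \<le> 6 * ((1 / 2) ^ l n * of_bool (update n t))"
      proof (rule mult_right_mono)
        have "card {e. e < K \<and> e < 6} \<le> card {..<6::nat}" by (rule card_mono) auto
        then show "real (card {e. e < K \<and> e < 6}) \<le> 6" by simp
      qed simp
      finally show ?thesis .
    qed
    then have inner: "(\<Sum>t<K. \<Sum>e<K. f n t e) \<le> 6 * ((1 / 2) ^ l n * (\<Sum>t<K. of_bool (update n t)))" for n
      unfolding sum_distrib_left by (intro sum_mono)
    have "(\<Sum>k<K. if P k then (1 / 2) ^ l (pfst k) else 0) = (\<Sum>k<K. f (pfst k) (pfst (psnd k)) (psnd (psnd k)))"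
      by (simp add: P_def f_def)
    also have "\<dots> \<le> (\<Sum>n<K. \<Sum>b<K. f n (pfst b) (psnd b))"
      by (rule sum_pair_le[of "\<lambda>n b. f n (pfst b) (psnd b)"]) (simp add: f_def)
    also have "\<dots> \<le> (\<Sum>n<K. \<Sum>t<K. \<Sum>e<K. f n t e)"
      by (intro sum_mono sum_pair_le) (simp add: f_def)
    also have "\<dots> \<le> (\<Sum>n<K. 6 * ((1 / 2) ^ l n * (\<Sum>t<K. of_bool (update n t))))"
      by (intro sum_mono inner)
    also have "\<dots> = 6 * (\<Sum>n<K. (1 / 2) ^ l n * (\<Sum>t<K. of_bool (update n t)))"
      by (simp only: sum_distrib_left)
    also have "\<dots> \<le> 2 ^ c'" using c[of K] c' by linarith
    finally show ?thesis .
  qed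
  have "decidable P" unfolding P_def by (intro recursive_intros)
  moreover have "recursive (\<lambda>k. l (pfst k))" by (intro recursive_comp[OF l(1)] recursive_intros)
  moreover have "recursive y" unfolding y_def by (intro recursive_intros)
  ultimately obtain d where d: "\<And>k. P k \<Longrightarrow> Hc U (str_of (y k)) \<le> enat (l (pfst k) + d)"
    using kraft_chaitin[OF U _ _ _ bound] by metis
  have "ereal_of_enat (Hc U (real_bits (Theta V T) n)) \<le> ereal (T * real n + real (d + 1))" for n
  proof -
    obtain t where t: "level n t \<le> nat \<lfloor>2 ^ n * Theta V T\<rfloor>" "nat \<lfloor>2 ^ n * Theta V T\<rfloor> < level n t + 6"
      using level_close by metis
    obtain t' where t': "update n t'" "level n t' = level n t" using last_update by metis
    define k where "k = pair n (pair t' (nat \<lfloor>2 ^ n * Theta V T\<rfloor> - level n t))"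
    have "P k" using t t' by (auto simp: P_def k_def)
    moreover have "str_of (y k) = real_bits (Theta V T) n"
      unfolding real_bits_eq_msb_string[OF Theta_nonneg] using t t' by (simp add: y_def k_def)
    ultimately have "Hc U (real_bits (Theta V T) n) \<le> enat (l n + d)" using d[of k] by (simp add: k_def)
    then have "ereal_of_enat (Hc U (real_bits (Theta V T) n)) \<le> ereal_of_enat (enat (l n + d))"
      by (simp only: ereal_of_enat_le_iff)
    also have "\<dots> \<le> ereal (T * real n + real (d + 1))" using l(2)[of n] by simp
    finally show ?thesis .
  qed
  then show ?thesis unfolding strictly_compressible_def by blast
qed

end

section \<open>Divergence\<close>

lemma finite_strings_le: "finite {s :: bool list. length s \<le> n}"
  using finite_lists_length_le[of "UNIV :: bool set" n] by simp

text \<open>The strings of length \<open>a * (r + 2)\<close> whose last \<open>2 * a\<close> bits vanish have programs of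
  length \<open>a * r + a + d\<close>, and for large \<open>r\<close> there are at least \<open>2 powr (a * (r + 2) / T)\<close> of them.\<close>

lemma compressible_strings_of_length:
  assumes V: "optimal_machine V"
  obtains d where "\<And>a. d < a \<Longrightarrow> 2 ^ (a * r) \<le> card {s \<in> Theta_set V. length s = a * (r + 2)}"
proof -
  define P where "P k \<longleftrightarrow> psnd k < 2 ^ (pfst k * r)" for k
  \<comment> \<open>With \<open>a = pfst k\<close>, the summand \<open>a\<close> makes the
    \<open>2 ^ (a * r)\<close> requests for one \<open>a\<close> weigh at most
    \<open>2 ^ - a\<close> in total. The \<open>2 * a\<close> appended zeros outweigh the overhead
    \<open>a + d\<close> once \<open>a > d\<close>.\<close>
  define l where "l k = pfst k * r + pfst k" for k
  define y where "y k = msb_code (pfst k * (r + 2)) (psnd k * 2 ^ (2 * pfst k))" for k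
  have bound: "(\<Sum>k<K. if P k then (1 / 2) ^ l k else 0) \<le> (2::real) ^ 1" for K
  proof -
    define f where "f a v = (if v < 2 ^ (a * r) then (1 / 2 :: real) ^ (a * r + a) else 0)" for a v :: nat
    have "(\<Sum>v<K. f a v) \<le> (1 / 2) ^ a" for a
    proof -
      have "(\<Sum>v<K. f a v) = (\<Sum>v\<in>{v. v < K \<and> v < 2 ^ (a * r)}. (1 / 2) ^ (a * r + a))"
        unfolding f_def by (intro sum.mono_neutral_cong_right) auto
      also have "\<dots> = real (card {v. v < K \<and> v < 2 ^ (a * r)}) * (1 / 2) ^ (a * r + a)" by simp
      also have "\<dots> \<le> real (2 ^ (a * r)) * (1 / 2) ^ (a * r + a)"
      proof (rule mult_right_mono)
        have "card {v. v < K \<and> v < 2 ^ (a * r)} \<le> card {..<2 ^ (a * r) :: nat}" by (rule card_mono) auto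
        then show "real (card {v. v < K \<and> v < 2 ^ (a * r)}) \<le> real (2 ^ (a * r))" by (simp only: of_nat_le_iff card_lessThan)
      qed simp
      also have "\<dots> = (1 / 2) ^ a" by (simp add: power_add power_one_over)
      finally show ?thesis .
    qed
    then have sum: "(\<Sum>a<K. \<Sum>v<K. f a v) \<le> (\<Sum>a<K. (1 / 2) ^ a)" by (intro sum_mono)
    have "(\<Sum>k<K. if P k then (1 / 2) ^ l k else 0) = (\<Sum>k<K. f (pfst k) (psnd k))"
      unfolding P_def f_def l_def ..
    also have "\<dots> \<le> (\<Sum>a<K. \<Sum>v<K. f a v)" by (rule sum_pair_le) (simp add: f_def)
    also note sum
    also have "(\<Sum>a<K. (1 / 2 :: real) ^ a) \<le> 2"
      using sum_geometric_inj_le[of "1 / 2" "{..<K}" "\<lambda>i. i"] by simp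
    finally show ?thesis by simp
  qed
  have "decidable P" unfolding P_def by (intro recursive_intros)
  moreover have "recursive l" unfolding l_def by (intro recursive_intros)
  moreover have "recursive y" unfolding y_def by (intro recursive_intros)
  ultimately obtain d where d: "\<And>k. P k \<Longrightarrow> Hc V (str_of (y k)) \<le> enat (l k + d)"
    using kraft_chaitin[OF V _ _ _ bound] by metis
  show thesis
  proof (rule that[of d])
    fix a assume a: "d < a"
    define s where "s v = msb_string (a * (r + 2)) (v * 2 ^ (2 * a))" for v
    have "s v \<in> {s \<in> Theta_set V. length s = a * (r + 2)}" if v: "v < 2 ^ (a * r)" for v
    proof -
      have "Hc V (s v) \<le> enat (a * r + a + d)"
        using d[of "pair a v"] v by (simp add: P_def y_def l_def s_def)
      also have "\<dots> < enat (length (s v))" using a by (simp add: s_def algebra_simps)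
      finally show ?thesis by (simp add: Theta_set_def s_def)
    qed
    then have sub: "s ` {..<2 ^ (a * r)} \<subseteq> {s \<in> Theta_set V. length s = a * (r + 2)}" by auto
    have "inj_on s {..<2 ^ (a * r)}"
    proof (rule inj_onI)
      fix v v' assume v: "v \<in> {..<2 ^ (a * r)}" "v' \<in> {..<2 ^ (a * r)}" and eq: "s v = s v'"
      have "j * 2 ^ (2 * a) < 2 ^ (a * (r + 2))" if "j < 2 ^ (a * r)" for j :: nat
      proof -
        have "(2::nat) ^ (a * (r + 2)) = 2 ^ (a * r) * 2 ^ (2 * a)" by (simp add: algebra_simps flip: power_add)
        then show ?thesis using that by simp
      qed
      then have "v * 2 ^ (2 * a) = v' * 2 ^ (2 * a)" using v eq unfolding s_def by (intro msb_string_inj) auto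
      then show "v = v'" by simp
    qed
    then have "2 ^ (a * r) = card (s ` {..<2 ^ (a * r)})" by (simp add: card_image)
    also have "\<dots> \<le> card {s \<in> Theta_set V. length s = a * (r + 2)}"
      by (rule card_mono[OF _ sub]) (rule finite_subset[OF _ finite_strings_le[of "a * (r + 2)"]], auto)
    finally show "2 ^ (a * r) \<le> card {s \<in> Theta_set V. length s = a * (r + 2)}" .
  qed
qed

text \<open>Different \<open>a\<close> give strings of different lengths, and each
  \<open>a > d\<close> contributes at least 1. \<open>T\<close> enters only through the natural
  number \<open>r\<close>, so the requests are effective for every real
  \<open>T > 1\<close>.\<close>

lemma Theta_diverges:
  assumes V: "optimal_machine V" and T: "1 < T"
  shows "filterlim (\<lambda>n. \<Sum>s\<in>{s \<in> Theta_set V. length s \<le> n}. Theta_term T s) at_top sequentially"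
proof -
  \<comment> \<open>The choice means \<open>(r + 2) / T < r\<close>, so \<open>2 ^ (a * r)\<close>
    terms of size \<open>2 powr (- a * (r + 2) / T)\<close> sum to at least 1. The constant
    \<open>d\<close> depends on \<open>r\<close>, which is therefore fixed first.\<close>
  obtain r :: nat where "real r > 2 / (T - 1)" using reals_Archimedean2 by blast
  then have r: "real (r + 2) / T \<le> real r" using T by (simp add: field_simps)
  obtain d where d: "\<And>a. d < a \<Longrightarrow> 2 ^ (a * r) \<le> card {s \<in> Theta_set V. length s = a * (r + 2)}"
    using compressible_strings_of_length[OF V] by metis
  define A where "A a = {s \<in> Theta_set V. length s = a * (r + 2)}" for a
  have finA: "finite (A a)" for a
    unfolding A_def by (rule finite_subset[OF _ finite_strings_le[of "a * (r + 2)"]]) auto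
  have disj: "A a \<inter> A b = {}" if "a \<noteq> b" for a b
  proof -
    have "r + 2 \<noteq> 0" by simp
    from mult_right_cancel[OF this, of a b] that have "a * (r + 2) \<noteq> b * (r + 2)" by blast
    then show ?thesis unfolding A_def by (auto simp only: Int_iff mem_Collect_eq)
  qed
  have one: "1 \<le> (\<Sum>s\<in>A a. Theta_term T s)" if "d < a" for a
  proof -
    have "real a * (real (r + 2) / T) \<le> real a * real r" by (intro mult_left_mono r) simp
    then have "real (a * (r + 2)) / T \<le> real (a * r)" by (simp only: of_nat_mult times_divide_eq_right)
    then have "2 powr 0 \<le> 2 powr (real (a * r) + - real (a * (r + 2)) / T)"
      unfolding minus_divide_left[symmetric] by (intro powr_mono) linarith+
    also have "\<dots> = real (2 ^ (a * r)) * 2 powr (- real (a * (r + 2)) / T)"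
      using powr_realpow[of 2 "a * r"] by (simp only: powr_add of_nat_power of_nat_numeral)
    finally have "1 \<le> real (2 ^ (a * r)) * 2 powr (- real (a * (r + 2)) / T)"
      by (simp only: powr_zero_eq_one) simp
    also have "\<dots> \<le> real (card (A a)) * 2 powr (- real (a * (r + 2)) / T)"
      unfolding A_def using d[OF that] by (intro mult_right_mono) (simp_all only: of_nat_le_iff powr_ge_zero)
    also have "\<dots> = (\<Sum>s\<in>A a. Theta_term T s)" by (simp add: A_def Theta_term_def)
    finally show ?thesis .
  qed
  have lower: "real m \<le> (\<Sum>s\<in>{s \<in> Theta_set V. length s \<le> n}. Theta_term T s)"
    if n: "(d + m) * (r + 2) \<le> n" for m n
  proof -
    have "real m = (\<Sum>a\<in>{d<..d + m}. 1)" by simp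
    also have "\<dots> \<le> (\<Sum>a\<in>{d<..d + m}. \<Sum>s\<in>A a. Theta_term T s)" by (intro sum_mono one) simp
    also have "\<dots> = (\<Sum>s\<in>(\<Union>a\<in>{d<..d + m}. A a). Theta_term T s)"
      by (rule sum.UNION_disjoint[symmetric]) (simp_all add: finA disj)
    also have "\<dots> \<le> (\<Sum>s\<in>{s \<in> Theta_set V. length s \<le> n}. Theta_term T s)"
    proof (rule sum_mono2)
      show "finite {s \<in> Theta_set V. length s \<le> n}"
        by (rule finite_subset[OF _ finite_strings_le[of n]]) auto
      show "(\<Union>a\<in>{d<..d + m}. A a) \<subseteq> {s \<in> Theta_set V. length s \<le> n}"
      proof
        fix s assume "s \<in> (\<Union>a\<in>{d<..d + m}. A a)"
        then obtain a where a: "a \<le> d + m" "s \<in> Theta_set V" "length s = a * (r + 2)" by (auto simp: A_def)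
        have "a * (r + 2) \<le> (d + m) * (r + 2)" using a(1) by (rule mult_le_mono1)
        then show "s \<in> {s \<in> Theta_set V. length s \<le> n}" using a n by simp
      qed
    qed (simp add: Theta_term_def)
    finally show ?thesis .
  qed
  show ?thesis unfolding filterlim_at_top
  proof
    fix Z :: real
    obtain m where m: "Z \<le> real m" using real_arch_simple by blast
    show "\<forall>\<^sub>F n in sequentially. Z \<le> (\<Sum>s\<in>{s \<in> Theta_set V. length s \<le> n}. Theta_term T s)"
      unfolding eventually_sequentially
      by (intro exI[of _ "(d + m) * (r + 2)"] allI impI order_trans[OF m] lower)
  qed
qed

lemma theta_enumeration_exists:
  assumes "prefix_free_machine V" "computable_real T" "0 < T" "T \<le> 1"
  obtains g W where "theta_enumeration V T g W"
proof -
  show thesis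
  proof (rule semidecidable_enumeration[OF semidecidable_Theta_set[OF assms(1)]])
    fix g
    assume g: "recursive g" "\<And>t s. g t = Suc s \<Longrightarrow> str_of s \<in> Theta_set V"
      "\<And>s. str_of s \<in> Theta_set V \<Longrightarrow> \<exists>t. g t = Suc s"
      "\<And>t t' s. g t = Suc s \<Longrightarrow> g t' = Suc s \<Longrightarrow> t = t'"
    show thesis
    proof (rule recursive_powr_approximation[OF assms(2,3)])
      fix W
      assume W: "recursive (\<lambda>z. W (pfst z) (psnd z))"
        "\<And>L N. real (W L N) < 2 powr (real N - real L / T)"
        "\<And>L N. 2 powr (real N - real L / T) < real (W L N) + 2"
      show thesis by (rule that[OF theta_enumeration.intro[OF assms(1,3,4) g W]])
    qed
  qed
qed

text \<open>\<open>infsum\<close> is 0 by default on a family that is not summable. Summability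
  therefore accompanies the claims on \<open>Theta V T\<close>, and divergence is expressed through
  partial sums over strings of bounded length.\<close>

theorem theorem7:
  fixes U V :: "bool list \<Rightarrow> bool list option" and T :: real
  assumes "optimal_machine U" and "optimal_machine V" and "T > 0"
  shows "(computable_real T \<and> T \<le> 1 \<longrightarrow>
            Theta_term T summable_on Theta_set V \<and>
            left_computable (Theta V T) \<and> weakly_Chaitin_random U T (Theta V T))
       \<and> (computable_real T \<and> T < 1 \<longrightarrow>
            Theta_term T summable_on Theta_set V \<and> strictly_compressible U T (Theta V T))
       \<and> (1 < T \<longrightarrow>
            filterlim (\<lambda>n. \<Sum>s \<in> {s \<in> Theta_set V. length s \<le> n}. Theta_term T s) at_top sequentially)"
proof (intro conjI impI)
  have V: "prefix_free_machine V" using assms(2) unfolding optimal_machine_def by blast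
  {
    assume T: "computable_real T \<and> T \<le> 1"
    from T have comp: "computable_real T" "T \<le> 1" by simp_all
    obtain g W where "theta_enumeration V T g W"
      using comp by (rule theta_enumeration_exists[OF V _ assms(3)])
    then interpret theta_enumeration V T g W .
    show "Theta_term T summable_on Theta_set V" by (rule Theta_summable)
    show "left_computable (Theta V T)" by (rule Theta_left_computable)
    show "weakly_Chaitin_random U T (Theta V T)" by (rule Theta_weakly_random[OF assms(1,2) comp(1)])
  }
  {
    assume T: "computable_real T \<and> T < 1"
    then have less: "T < 1" by simp
    from T have comp: "computable_real T" "T \<le> 1" by simp_all
    obtain g W where "theta_enumeration V T g W"
      using comp by (rule theta_enumeration_exists[OF V _ assms(3)])
    then interpret theta_enumeration V T g W .
    show "Theta_term T summable_on Theta_set V" by (rule Theta_summable)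
    show "strictly_compressible U T (Theta V T)" by (rule Theta_strictly_compressible[OF assms(1) comp(1) less])
  }
  show "filterlim (\<lambda>n. \<Sum>s \<in> {s \<in> Theta_set V. length s \<le> n}. Theta_term T s) at_top sequentially"
    if "1 < T" using assms(2) that by (rule Theta_diverges)
qed

end
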